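(* Let $f\in V$, let $h,\lambda,\mu>0$ be arbitrary, let $J=P_\lambda P_H I_h$, and let $U$ be a reference solution lying on the global attractor of the incompressible two-dimensional Navier--Stokes equations $\frac{dU}{dt}+\nu AU+B(U,U)=f$. For $\delta>0$ let $u=u^{(\delta)}$ be the approximating solution obtained by the relaxed direct-insertion method with relaxation parameter $\kappa=\mu\delta$ and observation times $t_n=t_0+\delta n$, and let $v$ be the solution of the continuous nudging equation with the same $\mu$ and $J$ and with $v(t_0)=u_0=JU(t_0)$. Then for every $T>t_0$, $$\sup\big\{\|u(t)-v(t)\|: t\in[t_0,T]\big\}\to 0\quad\text{as }\delta\to 0.$$ This holds for every $J=P_\lambda P_H I_h$, independently of whether $h$ and $\lambda$ have been chosen so that $\|u(t)-U(t)\|\to0$ or even $\|v(t)-U(t)\|\to 0$ as $t\to\infty$.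
   Context: Navier--Stokes setting. $\Omega=[0,L]^2$ with $L$-periodic boundary conditions, $\mathcal J=\{2\pi n/L: n\in\mathbf Z^2\setminus\{0\}\}$, and for real $\alpha$, $V_\alpha$ is the space of Fourier series $u=\sum_{k\in\mathcal J}u_ke^{ik\cdot x}$, $u_k\in\mathbf C^2$, with $k\cdot u_k=0$, $u_{-k}=\overline{u_k}$ and $\sum_k|k|^{2\alpha}|u_k|^2<\infty$, normed by $\|u\|_\alpha=(L^2\sum_k|k|^{2\alpha}|u_k|^2)^{1/2}$. Write $H=V_0$, $V=V_1$, $\mathcal D(A)=V_2$, with norms $|u|=\|u\|_0$, $\|u\|=\|u\|_1$, $|Au|=\|u\|_2$. $P_H$ is the orthogonal projection of $L^2(\Omega,\mathbf R^2)$ onto $H$; $A=-P_H\Delta$ (which equals $-\Delta$ here) and $B(u,v)=P_H(u\cdot\nabla v)$, extended continuously to $V\to V^*$ and $V\times V\to V^*$. The viscosity $\nu>0$ and the time-independent force $f$ (with $P_Hf=f$) are fixed. $S(t)$, $t\ge0$, is the solution semigroup on $V$: $S(t)U_0$ is the value at time $t$ of the unique solution of $\frac{dU}{dt}+\nu AU+B(U,U)=f$ with initial value $U_0$ at time $0$. $\mathcal A$ is the global attractor of $S$ (it is bounded in $\mathcal D(A)$); a solution $U$ lies on the global attractor if $U(t)\in\mathcal A$ for all $t$. Observations. $c_1>0$ is fixed and, for each $h>0$, $I_h:V\to L^2(\Omega)$ is a linear operator with $|U-P_HI_hU|^2\le c_1h^2\|U\|^2$ for every $U\in V$. For $\lambda>0$,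 $P_\lambda u=\sum_{0<|k|^2\le\lambda}u_ke^{ik\cdot x}$. Set $J=P_\lambda P_HI_h$. Relaxed direct-insertion method ($\kappa=\mu\delta$). For $t_n=t_0+\delta n$, $n=0,1,2,\dots$, put $u_0=JU(t_0)$, $u_{n+1}=S(\delta)u_n+\delta\mu J\{U(t_{n+1})-S(\delta)u_n\}$, and $u(t)=S(t-t_n)u_n$ for $t\in[t_n,t_{n+1})$. Continuous nudging. $v$ solves $\frac{dv}{dt}+\nu Av+B(v,v)=f+\mu J(U-v)$, $v(t_0)=u_0$. *)

theory Defs
  imports "HOL-Analysis.Analysis" "HOL-Library.Function_Algebras"
begin

text \<open>
  A Fourier series \<open>\<Sum>k. u\<^sub>k e\<^bsup>ik\<cdot>x\<^esup>\<close> is represented by its coefficient function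
  \<open>k \<mapsto> u\<^sub>k\<close>, indexed by the wave vectors themselves and equal to zero off the set of
  admissible wave vectors, so that equality of series is equality of functions.
  Sums and differences of series are the pointwise ones of \<open>Function_Algebras\<close>.
\<close>

type_synonym series = "real^2 \<Rightarrow> complex^2"

definition smul :: "real \<Rightarrow> series \<Rightarrow> series"  (infixr \<open>\<cdot>\<^sub>S\<close> 75) where
  "c \<cdot>\<^sub>S u = (\<lambda>k. c *\<^sub>R u k)"

definition wavevectors :: "real \<Rightarrow> (real^2) set" where
  "wavevectors L = {(\<chi> i. 2 * pi * of_int (n $ i) / L) | n :: int^2. n \<noteq> 0}"

definition cvec :: "real^2 \<Rightarrow> complex^2" where
  "cvec k = (\<chi> i. complex_of_real (k $ i))"

definition cnjv :: "complex^2 \<Rightarrow> complex^2" where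
  "cnjv a = (\<chi> i. cnj (a $ i))"

text \<open>The bilinear (not sesquilinear) product, as in \<open>k \<cdot> u\<^sub>k\<close>.\<close>

definition cdot :: "complex^2 \<Rightarrow> complex^2 \<Rightarrow> complex" where
  "cdot a b = (\<Sum>i\<in>UNIV. a $ i * b $ i)"

definition Vspace :: "real \<Rightarrow> real \<Rightarrow> series set" where
  "Vspace L \<alpha> = {u.
     (\<forall>k. k \<notin> wavevectors L \<longrightarrow> u k = 0) \<and>
     (\<forall>k\<in>wavevectors L. cdot (cvec k) (u k) = 0) \<and>
     (\<forall>k\<in>wavevectors L. u (- k) = cnjv (u k)) \<and>
     (\<lambda>k. norm k powr (2 * \<alpha>) * (norm (u k))\<^sup>2) summable_on wavevectors L}"

definition Vnorm :: "real \<Rightarrow> real \<Rightarrow> series \<Rightarrow> real" where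
  "Vnorm L \<alpha> u =
     sqrt (L\<^sup>2 * (\<Sum>\<^sub>\<infinity>k\<in>wavevectors L. norm k powr (2 * \<alpha>) * (norm (u k))\<^sup>2))"

definition Vtendsto :: "real \<Rightarrow> real \<Rightarrow> ('a \<Rightarrow> series) \<Rightarrow> series \<Rightarrow> 'a filter \<Rightarrow> bool" where
  "Vtendsto L \<alpha> w l F \<longleftrightarrow>
     (\<forall>\<^sub>F s in F. w s - l \<in> Vspace L \<alpha>) \<and> ((\<lambda>s. Vnorm L \<alpha> (w s - l)) \<longlongrightarrow> 0) F"

definition Omega :: "real \<Rightarrow> (real^2) set" where
  "Omega L = cbox 0 (\<chi> i. L)"

definition L2 :: "real \<Rightarrow> (real^2 \<Rightarrow> real^2) set" where
  "L2 L = {w. w \<in> borel_measurable (lebesgue_on (Omega L)) \<and>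
              integrable (lebesgue_on (Omega L)) (\<lambda>x. (norm (w x))\<^sup>2)}"

definition fourier_coeff :: "real \<Rightarrow> (real^2 \<Rightarrow> real^2) \<Rightarrow> series" where
  "fourier_coeff L w k = (\<chi> j. complex_of_real (1 / L\<^sup>2) *
     (LINT x|lebesgue_on (Omega L). complex_of_real (w x $ j) * cis (- (k \<bullet> x))))"

text \<open>
  \<open>P\<^sub>H\<close> in Fourier variables: the mean is removed and each other coefficient is projected
  orthogonally onto \<open>{c. k \<cdot> c = 0}\<close>.  Lemmas \<open>leray_in_H\<close> and \<open>leray_orthogonal\<close> below show
  that on square-summable real series this is the orthogonal projection onto \<open>V\<^sub>0 = H\<close>; the
  same formula is its continuous extension to series that are not square-summable, which is
  what \<open>B\<close> needs.
\<close>

definition leray :: "real \<Rightarrow> series \<Rightarrow> series" where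
  "leray L a k = (if k \<in> wavevectors L
     then a k - (cdot (cvec k) (a k) / complex_of_real ((norm k)\<^sup>2)) *s cvec k else 0)"

definition PH :: "real \<Rightarrow> (real^2 \<Rightarrow> real^2) \<Rightarrow> series" where
  "PH L w = leray L (fourier_coeff L w)"

text \<open>The Stokes operator \<open>A = - P\<^sub>H \<Delta> = - \<Delta>\<close>.\<close>

definition stokes :: "series \<Rightarrow> series" where
  "stokes u = (\<lambda>k. (norm k)\<^sup>2 *\<^sub>R u k)"

text \<open>
  Coefficients of \<open>u \<cdot> \<nabla>v\<close>: the product of \<open>u\<^sub>l e\<^bsup>il\<cdot>x\<^esup>\<close> with the gradient of
  \<open>v\<^sub>m e\<^bsup>im\<cdot>x\<^esup>\<close> contributes \<open>i (u\<^sub>l \<cdot> m) v\<^sub>m\<close> to the wave vector \<open>k = l + m\<close>.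
  For \<open>u, v\<close> in \<open>V\<close> the sum converges absolutely by Cauchy-Schwarz.
\<close>

definition advection :: "real \<Rightarrow> series \<Rightarrow> series \<Rightarrow> series" where
  "advection L u v k =
     (\<Sum>\<^sub>\<infinity>l\<in>wavevectors L. (\<i> * cdot (u l) (cvec (k - l))) *s v (k - l))"

definition B :: "real \<Rightarrow> series \<Rightarrow> series \<Rightarrow> series" where
  "B L u v = leray L (advection L u v)"

text \<open>
  \<open>w\<close> solves \<open>dw/dt + \<nu> A w + B(w,w) = g\<close> on \<open>[a, \<infinity>)\<close>: it is continuous into \<open>V\<close>, and the
  equation holds in \<open>V\<^sup>* = V\<^bsub>-1\<^esub>\<close> at every time (one-sided derivative at \<open>a\<close>).
\<close>

definition ns_solution ::
  "real \<Rightarrow> real \<Rightarrow> (real \<Rightarrow> series) \<Rightarrow> real \<Rightarrow> (real \<Rightarrow> series) \<Rightarrow> bool" where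
  "ns_solution L \<nu> g a w \<longleftrightarrow>
     (\<forall>t\<ge>a. w t \<in> Vspace L 1 \<and>
        Vtendsto L 1 w (w t) (at t within {a..}) \<and>
        Vtendsto L (- 1) (\<lambda>s. (1 / (s - t)) \<cdot>\<^sub>S (w s - w t))
          (g t - \<nu> \<cdot>\<^sub>S stokes (w t) - B L (w t) (w t)) (at t within {a..}))"

text \<open>Nothing is required of \<open>S t u\<close> for \<open>t < 0\<close> or \<open>u\<close> outside \<open>V\<close>.\<close>

definition solution_semigroup ::
  "real \<Rightarrow> real \<Rightarrow> series \<Rightarrow> (real \<Rightarrow> series \<Rightarrow> series) \<Rightarrow> bool" where
  "solution_semigroup L \<nu> f S \<longleftrightarrow>
     (\<forall>u0\<in>Vspace L 1. S 0 u0 = u0 \<and> ns_solution L \<nu> (\<lambda>_. f) 0 (\<lambda>t. S t u0))"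

text \<open>The compact invariant subset of \<open>V\<close> that attracts every bounded subset of \<open>V\<close>.\<close>

definition global_attractor ::
  "real \<Rightarrow> (real \<Rightarrow> series \<Rightarrow> series) \<Rightarrow> series set \<Rightarrow> bool" where
  "global_attractor L S Att \<longleftrightarrow>
     compactin (Metric_space.mtopology (Vspace L 1) (\<lambda>u v. Vnorm L 1 (u - v))) Att \<and>
     (\<forall>t\<ge>0. S t ` Att = Att) \<and>
     (\<forall>D R. D \<subseteq> Vspace L 1 \<and> (\<forall>u\<in>D. Vnorm L 1 u \<le> R) \<longrightarrow>
        (\<forall>\<epsilon>>0. \<exists>t0\<ge>0. \<forall>t\<ge>t0. \<forall>u\<in>D. \<exists>a\<in>Att. Vnorm L 1 (S t u - a) < \<epsilon>))"

text \<open>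
  A linear operator \<open>V \<rightarrow> L\<^sup>2(\<Omega>)\<close>, linearity being up to null sets because elements of
  \<open>L\<^sup>2\<close> are represented by functions, with the approximation property
  \<open>|U - P\<^sub>H I U|\<^sup>2 \<le> c\<^sub>1 h\<^sup>2 \<parallel>U\<parallel>\<^sup>2\<close>.
\<close>

definition interpolant ::
  "real \<Rightarrow> real \<Rightarrow> real \<Rightarrow> (series \<Rightarrow> real^2 \<Rightarrow> real^2) \<Rightarrow> bool" where
  "interpolant L c1 h Ih \<longleftrightarrow>
     (\<forall>u\<in>Vspace L 1. Ih u \<in> L2 L) \<and>
     (\<forall>u\<in>Vspace L 1. \<forall>v\<in>Vspace L 1. \<forall>a b.
        AE x in lebesgue_on (Omega L).
          Ih (a \<cdot>\<^sub>S u + b \<cdot>\<^sub>S v) x = a *\<^sub>R Ih u x + b *\<^sub>R Ih v x) \<and>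
     (\<forall>u\<in>Vspace L 1. (Vnorm L 0 (u - PH L (Ih u)))\<^sup>2 \<le> c1 * h\<^sup>2 * (Vnorm L 1 u)\<^sup>2)"

definition Plam :: "real \<Rightarrow> series \<Rightarrow> series" where
  "Plam lam u = (\<lambda>k. if 0 < (norm k)\<^sup>2 \<and> (norm k)\<^sup>2 \<le> lam then u k else 0)"

definition obs :: "real \<Rightarrow> real \<Rightarrow> (series \<Rightarrow> real^2 \<Rightarrow> real^2) \<Rightarrow> series \<Rightarrow> series" where
  "obs L lam Ih u = Plam lam (PH L (Ih u))"

primrec insertion_seq ::
  "(real \<Rightarrow> series \<Rightarrow> series) \<Rightarrow> (series \<Rightarrow> series) \<Rightarrow> (real \<Rightarrow> series) \<Rightarrow> real \<Rightarrow> real \<Rightarrow> real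
     \<Rightarrow> nat \<Rightarrow> series" where
  "insertion_seq S J U t0 \<delta> \<kappa> 0 = J (U t0)"
| "insertion_seq S J U t0 \<delta> \<kappa> (Suc n) =
     S \<delta> (insertion_seq S J U t0 \<delta> \<kappa> n) +
     \<kappa> \<cdot>\<^sub>S J (U (t0 + \<delta> * real (Suc n)) - S \<delta> (insertion_seq S J U t0 \<delta> \<kappa> n))"

text \<open>
  For \<open>\<delta> > 0\<close> and \<open>t \<ge> t0\<close> the integer \<open>n\<close> below is the one with \<open>t\<^sub>n \<le> t < t\<^bsub>n+1\<^esub>\<close>,
  where \<open>t\<^sub>n = t0 + \<delta> n\<close>.
\<close>

definition relaxed_insertion ::
  "(real \<Rightarrow> series \<Rightarrow> series) \<Rightarrow> (series \<Rightarrow> series) \<Rightarrow> (real \<Rightarrow> series) \<Rightarrow> real \<Rightarrow> real \<Rightarrow> real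
     \<Rightarrow> real \<Rightarrow> series" where
  "relaxed_insertion S J U t0 \<delta> \<kappa> t =
     (let n = nat \<lfloor>(t - t0) / \<delta>\<rfloor>
      in S (t - (t0 + \<delta> * real n)) (insertion_seq S J U t0 \<delta> \<kappa> n))"

lemma wavevectors_nonzero: "0 \<notin> wavevectors L" if "L > 0"
  using that by (auto simp: wavevectors_def vec_eq_iff)

lemma wavevectors_uminus: "- k \<in> wavevectors L" if "k \<in> wavevectors L"
proof -
  obtain n :: "int^2" where "n \<noteq> 0" "k = (\<chi> i. 2 * pi * of_int (n $ i) / L)"
    using \<open>k \<in> wavevectors L\<close> by (auto simp: wavevectors_def)
  then have "- n \<noteq> 0" "- k = (\<chi> i. 2 * pi * of_int ((- n) $ i) / L)"
    by (auto simp: vec_eq_iff)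
  then show ?thesis
    unfolding wavevectors_def by blast
qed

lemma cdot_cvec_cvec: "cdot (cvec k) (cvec k) = complex_of_real ((norm k)\<^sup>2)"
  by (simp add: cdot_def cvec_def norm_vec_def L2_set_def sum_2 power2_eq_square)

lemma leray_divfree:
  assumes "L > 0"
  shows "cdot (cvec k) (leray L a k) = 0"
proof (cases "k \<in> wavevectors L")
  case True
  then have "k \<noteq> 0" using wavevectors_nonzero[OF assms] by auto
  have "cdot (cvec k) (a k - c *s cvec k) = cdot (cvec k) (a k) - c * cdot (cvec k) (cvec k)" for c
    by (simp add: cdot_def sum_2 algebra_simps)
  then show ?thesis
    using True \<open>k \<noteq> 0\<close> by (simp add: leray_def cdot_cvec_cvec)
qed (simp add: leray_def cdot_def)

lemma leray_orthogonal:
  assumes "q \<in> Vspace L \<alpha>"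
  shows "cdot (a k - leray L a k) (cnjv (q k)) = 0"
proof (cases "k \<in> wavevectors L")
  case True
  then have "cdot (cvec k) (q k) = 0" using assms by (simp add: Vspace_def)
  then have "cnj (cdot (cvec k) (q k)) = 0" by simp
  then have "cdot (cvec k) (cnjv (q k)) = 0"
    by (simp add: cdot_def cvec_def cnjv_def sum_2)
  moreover have "cdot (c *s cvec k) (cnjv (q k)) = c * cdot (cvec k) (cnjv (q k))" for c
    by (simp add: cdot_def sum_2 algebra_simps)
  ultimately show ?thesis using True by (simp add: leray_def)
next
  case False
  then show ?thesis using assms by (simp add: Vspace_def cdot_def cnjv_def)
qed

lemma norm_leray_le:
  assumes "L > 0"
  shows "norm (leray L a k) \<le> norm (a k)"
proof (cases "k \<in> wavevectors L")
  case True
  define p c where "p = leray L a k"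
    and "c = cdot (cvec k) (a k) / complex_of_real ((norm k)\<^sup>2)"
  have a: "a k = p + c *s cvec k" using True by (simp add: p_def c_def leray_def)
  have "cdot (cvec k) p = 0" using leray_divfree[OF assms] by (simp add: p_def)
  then have "cnj c * cdot (cvec k) p = 0" by simp
  then have "inner p (c *s cvec k) = 0"
    by (simp add: cdot_def cvec_def inner_vec_def sum_2 inner_complex_def complex_eq_iff
        algebra_simps)
  then have "(norm (a k))\<^sup>2 = (norm p)\<^sup>2 + (norm (c *s cvec k))\<^sup>2"
    unfolding a by (simp add: norm_add_Pythagorean orthogonal_def)
  then have "(norm p)\<^sup>2 \<le> (norm (a k))\<^sup>2" by simp
  then show ?thesis by (simp add: p_def)
qed (simp add: leray_def)

lemma leray_in_H:
  assumes "L > 0" "\<forall>k. a (- k) = cnjv (a k)" "(\<lambda>k. (norm (a k))\<^sup>2) summable_on wavevectors L"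
  shows "leray L a \<in> Vspace L 0"
proof -
  have "leray L a (- k) = cnjv (leray L a k)" if k: "k \<in> wavevectors L" for k
  proof -
    have "cvec (- k) = - cvec k" "cnjv (cvec k) = cvec k"
      by (simp_all add: cvec_def cnjv_def vec_eq_iff)
    then show ?thesis
      using k wavevectors_uminus[OF k] assms(2)
      by (simp add: leray_def vec_eq_iff cnjv_def cdot_def cvec_def sum_2
          diff_divide_distrib add_divide_distrib algebra_simps)
  qed
  moreover have "(\<lambda>k. (norm (leray L a k))\<^sup>2) summable_on wavevectors L"
    using assms(3)
    by (rule summable_on_comparison_test) (use norm_leray_le[OF assms(1)] in auto)
  then have "(\<lambda>k. norm k powr (2 * 0) * (norm (leray L a k))\<^sup>2) summable_on wavevectors L"
    by (rule summable_on_cong[THEN iffD1, rotated])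
       (use wavevectors_nonzero[OF assms(1)] in auto)
  moreover have "leray L a k = 0" if "k \<notin> wavevectors L" for k
    using that by (simp add: leray_def)
  ultimately show ?thesis
    using leray_divfree[OF assms(1)] by (simp add: Vspace_def)
qed

lemma fourier_coeff_uminus: "fourier_coeff L w (- k) = cnjv (fourier_coeff L w k)"
proof -
  have "(LINT x|M. complex_of_real (w x $ j) * cis (k \<bullet> x)) =
        cnj (LINT x|M. complex_of_real (w x $ j) * cis (- (k \<bullet> x)))" for M j
    unfolding Bochner_Integration.integral_cnj[symmetric] by (simp add: cis_cnj)
  then show ?thesis
    by (simp add: fourier_coeff_def cnjv_def vec_eq_iff)
qed

end

theory Submission
  imports Defs
begin

text \<open>
  Subtracting the two equations on each observation interval and passing to the mild formulation
  leaves only the bilinear difference and the nudging term \<open>y = \<mu> J (U - v)\<close>. A relaxed insertion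
  adds \<open>\<delta> y\<close>, up to \<open>\<mu> \<delta> J\<close> of the error, at each observation time. Since \<open>y\<close> is continuous into a
  finite-dimensional space, the accumulated jumps cancel the integral of \<open>y\<close> up to \<open>o(1)\<close>.
  As \<open>B\<close> maps \<open>V \<times> V\<close> into \<open>V\<^bsub>-1/2\<^esub>\<close> and the heat semigroup maps \<open>V\<^bsub>-1/2\<^esub>\<close> to \<open>V\<close> with norm
  \<open>O(r\<^bsup>-3/4\<^esup>)\<close>, a Gronwall argument in \<open>V\<close> with an exponential weight \<open>e\<^bsup>\<beta>t\<^esup>\<close>, \<open>\<beta>\<close> large, closes on
  all of \<open>[t\<^sub>0, T]\<close> at once. It starts from a zero error and controls the quadratic part of the
  difference as long as the error stays below 1, so the first failure of the bound is excluded.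

  The mild formulation is used in dual form: \<open>w(s)\<close> is paired with itself through
  \<open>\<tau> \<mapsto> \<langle>w(s), e\<^bsup>-\<nu>(s-\<tau>)A\<^esup> w(\<tau>)\<rangle>\<close>, restricted to finitely many modes, so that only real derivatives
  are integrated.
\<close>

text \<open>An energy estimate in V would pair the equation with A w and so need w in V_2, whereas a
  solution is only continuous into V and satisfies its equation in V_{-1}. The heat semigroup
  supplies the 3/2 derivatives between V_{-1/2} and V instead. Freezing the test series at w(s)
  keeps everything a finite real sum: no series-valued integral and no measurability of B(w,w) in
  time is involved, and all bounds are uniform in the modes tested. The obstacle is the number of
  insertions. About (T - t_0)/\<delta> jumps of size O(\<delta>) occur, so bounding each one is not
  enough; each must cancel the force accumulated since the previous one, up to \<delta> times a
  modulus of continuity. Large \<beta> makes both the kernel term (factor \<beta>^{-1/8}) and the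
  feedback of J on the error (factor 1/\<beta>) a small multiple of the weight, so the interval is
  not cut into short pieces. The exponent 1/8 is one choice below 1/4: it leaves the kernel
  r^{-7/8}, still integrable.\<close>

lemma smul_apply [simp]: "(c \<cdot>\<^sub>S u) k = c *\<^sub>R u k"
  by (simp add: smul_def)

section \<open>Weighted square-summable norms and the spaces V_\<alpha>\<close>

lemma Vspace_zero_off: "u \<in> Vspace L \<alpha> \<Longrightarrow> k \<notin> wavevectors L \<Longrightarrow> u k = 0"
  by (simp add: Vspace_def)

lemma Vnorm_nonneg: "0 \<le> Vnorm L \<alpha> u"
  by (simp add: Vnorm_def infsum_nonneg)

text \<open>As the series vanishes off the lattice, the sum may run over the whole plane, where the
  reflections l to k - l of a convolution are bijections; the lattice omits 0 and is not invariant
  under them. Membership in \<open>Vspace\<close> is not asked for because one use concerns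
  \<open>u - PH L (Ih u)\<close>, for which only support and summability are at hand.\<close>

lemma has_sum_Vnorm:
  assumes "L > 0" "\<And>k. k \<notin> wavevectors L \<Longrightarrow> u k = 0"
    and "(\<lambda>k. norm k powr (2 * \<alpha>) * (norm (u k))\<^sup>2) summable_on wavevectors L"
  shows "((\<lambda>k. norm k powr (2 * \<alpha>) * (norm (u k))\<^sup>2) has_sum (Vnorm L \<alpha> u / L)\<^sup>2) UNIV"
proof -
  let ?q = "\<lambda>k. norm k powr (2 * \<alpha>) * (norm (u k))\<^sup>2"
  have "0 \<le> infsum ?q (wavevectors L)"
    by (simp add: infsum_nonneg)
  then have "(Vnorm L \<alpha> u / L)\<^sup>2 = infsum ?q (wavevectors L)"
    using \<open>L > 0\<close> by (simp add: Vnorm_def power_divide)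
  moreover have "(?q has_sum infsum ?q (wavevectors L)) (wavevectors L)"
    using assms(3) by simp
  moreover have "(?q has_sum infsum ?q (wavevectors L)) (wavevectors L)
      \<longleftrightarrow> (?q has_sum infsum ?q (wavevectors L)) UNIV"
    by (rule has_sum_cong_neutral) (use assms(2) in auto)
  ultimately show ?thesis by simp
qed

lemma has_sum_Vnorm1:
  assumes "L > 0" "u \<in> Vspace L 1"
  shows "((\<lambda>k. (norm k * norm (u k))\<^sup>2) has_sum (Vnorm L 1 u / L)\<^sup>2) UNIV"
proof -
  have "(\<lambda>k. norm k powr (2 * 1) * (norm (u k))\<^sup>2) = (\<lambda>k. (norm k * norm (u k))\<^sup>2)"
    by (simp add: power_mult_distrib)
  then show ?thesis
    using has_sum_Vnorm[of L u 1] assms by (auto simp: Vspace_def)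
qed

lemma L2_set_le_Vnorm1:
  assumes "L > 0" "u \<in> Vspace L 1"
  shows "L2_set (\<lambda>k. norm k * norm (u k)) F \<le> Vnorm L 1 u / L"
proof (cases "finite F")
  case True
  have "(\<Sum>k\<in>F. (norm k * norm (u k))\<^sup>2) \<le> (Vnorm L 1 u / L)\<^sup>2"
    by (rule finite_sum_le_has_sum[OF has_sum_Vnorm1[OF assms] True]) auto
  then show ?thesis
    unfolding L2_set_def using assms(1) Vnorm_nonneg by (auto intro: real_le_lsqrt)
qed (use assms(1) Vnorm_nonneg in simp)

text \<open>Bounded finite sums already give summability, so the default value 0 of
  \<open>infsum\<close> cannot interfere. This carries estimates uniform in a finite set of modes
  over to the norm of V.\<close>

lemma Vnorm1_le:
  assumes "L > 0" "0 \<le> c" "\<And>F. finite F \<Longrightarrow> L2_set (\<lambda>k. norm k * norm (u k)) F \<le> c"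
  shows "Vnorm L 1 u \<le> L * c"
proof -
  let ?q = "\<lambda>k. norm k powr (2 * 1) * (norm (u k))\<^sup>2"
  have q: "?q = (\<lambda>k. (norm k * norm (u k))\<^sup>2)"
    by (simp add: power_mult_distrib)
  have *: "sum ?q F \<le> c\<^sup>2" if "finite F" for F
    using assms(3)[OF that] unfolding q L2_set_def
    by (metis assms(2) real_sqrt_le_iff real_sqrt_unique)
  then have "?q summable_on wavevectors L"
    by (intro nonneg_bounded_partial_sums_imp_summable_on[where C = "c\<^sup>2"])
       (auto simp: eventually_finite_subsets_at_top intro!: exI[of _ "{}"])
  then have "infsum ?q (wavevectors L) \<le> c\<^sup>2"
    using * by (intro infsum_le_finite_sums) auto
  then have "L\<^sup>2 * infsum ?q (wavevectors L) \<le> L\<^sup>2 * c\<^sup>2"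
    by (simp add: mult_left_mono)
  also have "\<dots> = (L * c)\<^sup>2"
    by (simp add: power_mult_distrib)
  finally show ?thesis
    unfolding Vnorm_def using assms by (intro real_le_lsqrt) auto
qed

lemma norm_coeff_le_Vnorm:
  assumes "L > 0" "\<And>k. k \<notin> wavevectors L \<Longrightarrow> u k = 0"
    and "(\<lambda>k. norm k powr (2 * \<alpha>) * (norm (u k))\<^sup>2) summable_on wavevectors L"
  shows "L * norm k powr \<alpha> * norm (u k) \<le> Vnorm L \<alpha> u"
proof -
  have "(\<Sum>k\<in>{k}. norm k powr (2 * \<alpha>) * (norm (u k))\<^sup>2) \<le> (Vnorm L \<alpha> u / L)\<^sup>2"
    by (rule finite_sum_le_has_sum[OF has_sum_Vnorm[OF assms]]) auto
  also have "(\<Sum>k\<in>{k}. norm k powr (2 * \<alpha>) * (norm (u k))\<^sup>2) = (norm k powr \<alpha> * norm (u k))\<^sup>2"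
    by (simp add: power_mult_distrib powr_add[symmetric] power2_eq_square)
  finally have "norm k powr \<alpha> * norm (u k) \<le> Vnorm L \<alpha> u / L"
    by (rule power2_le_imp_le) (use assms(1) Vnorm_nonneg in auto)
  then show ?thesis
    using assms(1) by (simp add: field_simps)
qed

lemma Vspace_lincomb:
  assumes "u \<in> Vspace L \<alpha>" "v \<in> Vspace L \<alpha>"
  shows "a \<cdot>\<^sub>S u + b \<cdot>\<^sub>S v \<in> Vspace L \<alpha>"
proof -
  let ?w = "a \<cdot>\<^sub>S u + b \<cdot>\<^sub>S v"
  have "(\<lambda>k. 2 * a\<^sup>2 * (norm k powr (2 * \<alpha>) * (norm (u k))\<^sup>2)
      + 2 * b\<^sup>2 * (norm k powr (2 * \<alpha>) * (norm (v k))\<^sup>2)) summable_on wavevectors L"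
    using assms by (intro summable_on_add summable_on_cmult_right) (auto simp: Vspace_def)
  then have "(\<lambda>k. norm k powr (2 * \<alpha>) * (norm (?w k))\<^sup>2) summable_on wavevectors L"
  proof (rule summable_on_comparison_test)
    fix k :: "real^2"
    have "norm (?w k) \<le> \<bar>a\<bar> * norm (u k) + \<bar>b\<bar> * norm (v k)"
      using norm_triangle_ineq[of "a *\<^sub>R u k" "b *\<^sub>R v k"] by simp
    then have "(norm (?w k))\<^sup>2 \<le> (\<bar>a\<bar> * norm (u k) + \<bar>b\<bar> * norm (v k))\<^sup>2"
      by (intro power_mono) auto
    also have "\<dots> \<le> 2 * (\<bar>a\<bar> * norm (u k))\<^sup>2 + 2 * (\<bar>b\<bar> * norm (v k))\<^sup>2"
      using sum_squares_bound[of "\<bar>a\<bar> * norm (u k)" "\<bar>b\<bar> * norm (v k)"]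
      by (simp add: power2_sum)
    finally have "norm k powr (2 * \<alpha>) * (norm (?w k))\<^sup>2
        \<le> norm k powr (2 * \<alpha>) * (2 * (\<bar>a\<bar> * norm (u k))\<^sup>2 + 2 * (\<bar>b\<bar> * norm (v k))\<^sup>2)"
      by (intro mult_left_mono) auto
    then show "norm k powr (2 * \<alpha>) * (norm (?w k))\<^sup>2
        \<le> 2 * a\<^sup>2 * (norm k powr (2 * \<alpha>) * (norm (u k))\<^sup>2)
          + 2 * b\<^sup>2 * (norm k powr (2 * \<alpha>) * (norm (v k))\<^sup>2)"
      by (simp add: power_mult_distrib algebra_simps)
  qed auto
  moreover have "cdot (cvec k) (?w k) = 0" if "k \<in> wavevectors L" for k
  proof -
    have "cdot (cvec k) (?w k) = a *\<^sub>R cdot (cvec k) (u k) + b *\<^sub>R cdot (cvec k) (v k)"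
      by (simp add: cdot_def sum_2 algebra_simps)
    then show ?thesis using assms that by (simp add: Vspace_def)
  qed
  moreover have "?w (- k) = cnjv (?w k)" if "k \<in> wavevectors L" for k
    using assms that by (simp add: Vspace_def cnjv_def vec_eq_iff)
  ultimately show ?thesis
    using assms by (simp add: Vspace_def)
qed

lemma Vspace_add: "u \<in> Vspace L \<alpha> \<Longrightarrow> v \<in> Vspace L \<alpha> \<Longrightarrow> u + v \<in> Vspace L \<alpha>"
  and Vspace_diff: "u \<in> Vspace L \<alpha> \<Longrightarrow> v \<in> Vspace L \<alpha> \<Longrightarrow> u - v \<in> Vspace L \<alpha>"
  and Vspace_smul: "u \<in> Vspace L \<alpha> \<Longrightarrow> c \<cdot>\<^sub>S u \<in> Vspace L \<alpha>"
  using Vspace_lincomb[of u L \<alpha> v 1 1] Vspace_lincomb[of u L \<alpha> v 1 "-1"]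
    Vspace_lincomb[of u L \<alpha> u c 0]
  by (simp_all add: smul_def fun_eq_iff plus_fun_def fun_diff_def)

lemma Vnorm1_add_le:
  assumes "L > 0" "u \<in> Vspace L 1" "v \<in> Vspace L 1"
  shows "Vnorm L 1 (u + v) \<le> Vnorm L 1 u + Vnorm L 1 v"
proof -
  have "Vnorm L 1 (u + v) \<le> L * (Vnorm L 1 u / L + Vnorm L 1 v / L)"
  proof (rule Vnorm1_le[OF assms(1)])
    fix F :: "(real^2) set"
    have "L2_set (\<lambda>k. norm k * norm ((u + v) k)) F
        \<le> L2_set (\<lambda>k. norm k * norm (u k) + norm k * norm (v k)) F"
      by (intro L2_set_mono)
         (auto simp: distrib_left[symmetric] intro!: mult_left_mono norm_triangle_ineq)
    also have "\<dots> \<le> L2_set (\<lambda>k. norm k * norm (u k)) F + L2_set (\<lambda>k. norm k * norm (v k)) F"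
      by (rule L2_set_triangle_ineq)
    finally show "L2_set (\<lambda>k. norm k * norm ((u + v) k)) F \<le> Vnorm L 1 u / L + Vnorm L 1 v / L"
      using L2_set_le_Vnorm1[OF assms(1,2), of F] L2_set_le_Vnorm1[OF assms(1,3), of F] by linarith
  qed (use assms(1) Vnorm_nonneg in auto)
  then show ?thesis using assms(1) by (simp add: distrib_left)
qed

lemma Vnorm_minus_commute: "Vnorm L \<alpha> (u - v) = Vnorm L \<alpha> (v - u)"
  by (simp add: Vnorm_def norm_minus_commute)

lemma Vnorm1_diff_le:
  assumes "L > 0" "u \<in> Vspace L 1" "v \<in> Vspace L 1"
  shows "Vnorm L 1 (u - v) \<le> Vnorm L 1 u + Vnorm L 1 v"
proof -
  have "u - v = u + (-1) \<cdot>\<^sub>S v" by (simp add: fun_eq_iff)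
  then have "Vnorm L 1 (u - v) \<le> Vnorm L 1 u + Vnorm L 1 ((-1) \<cdot>\<^sub>S v)"
    using Vnorm1_add_le[of L u "(-1) \<cdot>\<^sub>S v"] assms Vspace_smul[of v L 1 "-1"] by metis
  then show ?thesis by (simp add: Vnorm_def)
qed

lemma abs_Vnorm1_diff_le:
  assumes "L > 0" "u \<in> Vspace L 1" "v \<in> Vspace L 1"
  shows "\<bar>Vnorm L 1 u - Vnorm L 1 v\<bar> \<le> Vnorm L 1 (u - v)"
  using Vnorm1_add_le[OF assms(1) Vspace_diff[OF assms(2,3)] assms(3)]
    Vnorm1_add_le[OF assms(1) Vspace_diff[OF assms(3,2)] assms(2)] Vnorm_minus_commute[of L 1 u v]
  by simp

section \<open>The lattice of wave vectors\<close>

lemma wavevectors_cases: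
  assumes "k \<in> wavevectors L"
  obtains n :: "int^2" where "n \<noteq> 0" "k = (2 * pi / L) *\<^sub>R (\<chi> i. of_int (n $ i))"
  using assms by (auto simp: wavevectors_def vec_eq_iff)

lemma norm_vec2: "(norm (x :: real^2))\<^sup>2 = (x $ 1)\<^sup>2 + (x $ 2)\<^sup>2"
  by (simp add: norm_vec_def L2_set_def sum_2)

text \<open>The squared length of a nonzero integer vector is a positive integer. This spectral gap
  is the Poincare inequality in Fourier variables.\<close>

lemma norm_wavevector_ge:
  assumes "L > 0" "k \<in> wavevectors L"
  shows "2 * pi / L \<le> norm k"
proof -
  obtain n :: "int^2" where n: "n \<noteq> 0" "k = (2 * pi / L) *\<^sub>R (\<chi> i. of_int (n $ i))"
    using assms by (auto elim: wavevectors_cases)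
  have "(n $ 1)\<^sup>2 + (n $ 2)\<^sup>2 > 0"
    using n(1) by (auto simp: sum_power2_gt_zero_iff vec_eq_iff forall_2)
  then have "real_of_int ((n $ 1)\<^sup>2 + (n $ 2)\<^sup>2) \<ge> 1"
    by linarith
  then have "1 \<le> (norm (\<chi> i. real_of_int (n $ i) :: real^2))\<^sup>2"
    by (simp add: norm_vec2)
  then have "1 \<le> norm (\<chi> i. real_of_int (n $ i) :: real^2)"
    by (metis norm_ge_zero one_power2 power2_le_imp_le)
  then have "2 * pi / L * 1 \<le> 2 * pi / L * norm (\<chi> i. real_of_int (n $ i) :: real^2)"
    using assms by (intro mult_left_mono) auto
  then show ?thesis
    using assms by (simp add: n(2))
qed

lemma finite_wavevectors_le:
  assumes "L > 0"
  shows "finite {k \<in> wavevectors L. (norm k)\<^sup>2 \<le> lam}"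
proof -
  define m where "m = \<lceil>\<bar>lam\<bar> * (L / (2 * pi))\<^sup>2\<rceil>"
  let ?g = "\<lambda>(a :: int, b :: int). vector [2 * pi / L * of_int a, 2 * pi / L * of_int b] :: real^2"
  have "{k \<in> wavevectors L. (norm k)\<^sup>2 \<le> lam} \<subseteq> ?g ` ({-m..m} \<times> {-m..m})"
  proof
    fix k assume "k \<in> {k \<in> wavevectors L. (norm k)\<^sup>2 \<le> lam}"
    then have "k \<in> wavevectors L" and le: "(norm k)\<^sup>2 \<le> lam" by auto
    then obtain n :: "int^2" where k: "k = (2 * pi / L) *\<^sub>R (\<chi> i. of_int (n $ i))"
      by (auto elim: wavevectors_cases)
    have "n $ i \<in> {-m..m}" for i
    proof -
      have "(k $ i)\<^sup>2 \<le> lam"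
        using le exhaust_2[of i] by (auto simp: norm_vec2) (smt (verit) zero_le_power2)+
      then have "(2 * pi / L)\<^sup>2 * (real_of_int (n $ i))\<^sup>2 \<le> \<bar>lam\<bar>"
        by (simp add: k power_mult_distrib power_divide)
      then have "(real_of_int (n $ i))\<^sup>2 \<le> \<bar>lam\<bar> * (L / (2 * pi))\<^sup>2"
        using assms by (simp add: field_simps)
      also have "\<dots> \<le> real_of_int m"
        unfolding m_def by linarith
      finally have "(n $ i)\<^sup>2 \<le> m"
        by (metis of_int_le_iff of_int_power)
      moreover have "\<bar>n $ i\<bar> \<le> (n $ i)\<^sup>2"
        using self_le_power[of "\<bar>n $ i\<bar>" 2] by (cases "n $ i = 0") auto
      ultimately show ?thesis by auto
    qed
    moreover have "k = ?g (n $ 1, n $ 2)"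
      by (simp add: k vec_eq_iff forall_2)
    ultimately show "k \<in> ?g ` ({-m..m} \<times> {-m..m})"
      by (intro rev_image_eqI[of "(n $ 1, n $ 2)"]) auto
  qed
  then show ?thesis
    by (rule finite_subset) auto
qed

text \<open>The terms decay like |n|^{-3/2}. The exponent is chosen so that a product of two such
  terms dominates a multiple of |k|^{-3} in the plane.\<close>

lemma summable_on_int_inverse_powr: "(\<lambda>n :: int. (1 + (of_int n)\<^sup>2 :: real) powr (-3/4)) summable_on UNIV"
proof -
  let ?g = "\<lambda>n :: int. (1 + (of_int n)\<^sup>2 :: real) powr (-3/4)"
  have le: "(1 + (real n)\<^sup>2) powr (-3/4) \<le> real n powr (-3/2)" if "n > 0" for n
  proof -
    have "(1 + (real n)\<^sup>2) powr (-3/4) \<le> ((real n)\<^sup>2) powr (-3/4)"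
      using that by (intro powr_mono2') auto
    also have "\<dots> = real n powr (-3/2)"
      using that by (simp add: powr_numeral[symmetric] powr_powr del: powr_numeral)
    finally show ?thesis .
  qed
  have "summable (\<lambda>n. real n powr (-3/2))"
    by (subst summable_real_powr_iff) simp
  then have "summable (\<lambda>n. (1 + (real n)\<^sup>2) powr (-3/4))"
    by (rule summable_comparison_test'[where N = 1]) (use le in simp)
  then have "(\<lambda>n. (1 + (real n)\<^sup>2) powr (-3/4)) summable_on UNIV"
    by (intro summable_nonneg_imp_summable_on) auto
  then have "?g summable_on range int" "?g summable_on range (\<lambda>n. - int n)"
    by (subst summable_on_reindex; simp add: o_def inj_on_def)+
  moreover have "UNIV = range int \<union> range (\<lambda>n. - int n)"
    by (auto simp: image_iff) (metis int_cases2)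
  ultimately show ?thesis
    by (metis summable_on_union)
qed

lemma summable_on_product_nonneg:
  fixes f :: "'a \<Rightarrow> real" and g :: "'b \<Rightarrow> real"
  assumes "f summable_on A" "g summable_on Y"
    and "\<And>a. a \<in> A \<Longrightarrow> 0 \<le> f a" "\<And>b. b \<in> Y \<Longrightarrow> 0 \<le> g b"
  shows "(\<lambda>(a, b). f a * g b) summable_on A \<times> Y"
proof (rule summable_on_SigmaI)
  show "((\<lambda>b. case (a, b) of (a, b) \<Rightarrow> f a * g b) has_sum f a * infsum g Y) Y" for a
    using has_sum_cmult_right[of g Y _ "f a"] assms(2) by auto
qed (use assms in \<open>auto intro!: summable_on_cmult_left\<close>)

text \<open>The power 3 exceeds the dimension 2. Instead of counting lattice points in annuli, the
  sum is compared with a product of two one-dimensional sums: (1 + a^2)(1 + b^2) <= (2 s)^4 with s =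
  |(a, b)| >= 1, raised to the power -3/4.\<close>

lemma summable_on_norm_inverse_cube:
  assumes "L > 0"
  shows "(\<lambda>k. inverse (norm k ^ 3)) summable_on wavevectors L"
proof -
  let ?g = "\<lambda>n :: int. (1 + (of_int n)\<^sup>2 :: real) powr (-3/4)"
  let ?k = "\<lambda>(a :: int, b :: int). vector [2 * pi / L * of_int a, 2 * pi / L * of_int b] :: real^2"
  let ?X = "UNIV - {(0, 0)} :: (int \<times> int) set"
  define C where "C = (L / pi) ^ 3"
  have "(\<lambda>(a, b). ?g a * ?g b) summable_on UNIV \<times> UNIV"
    by (rule summable_on_product_nonneg[OF summable_on_int_inverse_powr
          summable_on_int_inverse_powr]) auto
  then have "(\<lambda>x. C * (case x of (a, b) \<Rightarrow> ?g a * ?g b)) summable_on ?X"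
    by (intro summable_on_cmult_right) (auto intro: summable_on_subset)
  then have "(\<lambda>x. inverse (norm (?k x) ^ 3)) summable_on ?X"
  proof (rule summable_on_comparison_test)
    fix x assume "x \<in> ?X"
    then obtain a b where x: "x = (a, b)" "a \<noteq> 0 \<or> b \<noteq> 0" by (cases x) auto
    define s where "s = sqrt ((real_of_int a)\<^sup>2 + (real_of_int b)\<^sup>2)"
    have "a\<^sup>2 + b\<^sup>2 \<ge> 1"
      using x(2) sum_power2_gt_zero_iff[of a b] by linarith
    then have "real_of_int (a\<^sup>2 + b\<^sup>2) \<ge> 1"
      by linarith
    then have s1: "s\<^sup>2 \<ge> 1" and s2: "s\<^sup>2 = (real_of_int a)\<^sup>2 + (real_of_int b)\<^sup>2" and "s > 0"
      by (auto simp: s_def)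
    have "(norm (?k x))\<^sup>2 = (2 * pi / L * s)\<^sup>2"
      by (simp add: x norm_vec2 s2 power_mult_distrib power_divide add_divide_distrib
          distrib_left)
    then have n: "norm (?k x) = 2 * pi / L * s"
      by (rule power2_eq_imp_eq) (use assms \<open>s > 0\<close> in auto)
    have "(1 + (real_of_int a)\<^sup>2) * (1 + (real_of_int b)\<^sup>2)
        = 1 + s\<^sup>2 + (real_of_int a)\<^sup>2 * (real_of_int b)\<^sup>2"
      by (simp add: s2 algebra_simps)
    also have "\<dots> \<le> 1 + s\<^sup>2 + s\<^sup>2 * s\<^sup>2"
      unfolding s2 by (intro add_left_mono mult_mono) auto
    also have "\<dots> \<le> 16 * (s\<^sup>2 * s\<^sup>2)"
      using s1 mult_mono[OF s1 s1] mult_left_mono[OF s1, of "s\<^sup>2"] by linarith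
    also have "\<dots> = (2 * s) ^ 4"
      by (simp add: power_mult_distrib)
    finally have le: "(1 + (real_of_int a)\<^sup>2) * (1 + (real_of_int b)\<^sup>2) \<le> (2 * s) ^ 4" .
    have "inverse (norm (?k x) ^ 3) = C * inverse ((2 * s) ^ 3)"
      unfolding n using assms \<open>s > 0\<close> by (simp add: C_def power_mult_distrib power_divide field_simps)
    also have "inverse ((2 * s) ^ 3) = (2 * s) powr (- 3)"
      using \<open>s > 0\<close> by (simp add: powr_minus)
    also have "\<dots> = ((2 * s) ^ 4) powr (- 3 / 4)"
      using \<open>s > 0\<close> powr_powr[of "2 * s" 4 "- 3 / 4"] by simp
    also have "\<dots> \<le> ((1 + (real_of_int a)\<^sup>2) * (1 + (real_of_int b)\<^sup>2)) powr (- 3 / 4)"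
      by (intro powr_mono2' le) (auto intro!: mult_pos_pos add_pos_nonneg)
    also have "\<dots> = ?g a * ?g b"
      by (rule powr_mult)
    finally show "inverse (norm (?k x) ^ 3) \<le> C * (case x of (a, b) \<Rightarrow> ?g a * ?g b)"
      using assms by (simp add: x C_def mult_left_mono)
  qed auto
  moreover have "inj_on ?k ?X"
    using assms by (auto simp: inj_on_def vec_eq_iff forall_2)
  ultimately have "(\<lambda>k. inverse (norm k ^ 3)) summable_on ?k ` ?X"
    by (subst summable_on_reindex) (auto simp: o_def)
  moreover have "wavevectors L \<subseteq> ?k ` ?X"
  proof
    fix k assume "k \<in> wavevectors L"
    then obtain n :: "int^2" where n: "n \<noteq> 0" "k = (2 * pi / L) *\<^sub>R (\<chi> i. of_int (n $ i))"
      by (auto elim: wavevectors_cases)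
    then have "(n $ 1, n $ 2) \<in> ?X" "k = ?k (n $ 1, n $ 2)"
      by (auto simp: vec_eq_iff forall_2)
    then show "k \<in> ?k ` ?X" by (rule rev_image_eqI)
  qed
  ultimately show ?thesis
    by (rule summable_on_subset)
qed

section \<open>The bilinear term\<close>

lemma norm_cvec [simp]: "norm (cvec k) = norm k"
  by (simp add: norm_vec_def cvec_def)

lemma norm_smult_vec: "norm (c *s (x :: complex^'n)) = cmod c * norm x"
  by (simp add: norm_vec_def norm_mult L2_set_right_distrib)

lemma norm_cdot_le: "cmod (cdot a b) \<le> norm a * norm b"
proof -
  have "cmod (cdot a b) \<le> (\<Sum>i\<in>UNIV. cmod (a $ i * b $ i))"
    unfolding cdot_def by (rule norm_sum)
  also have "\<dots> = (\<Sum>i\<in>UNIV. \<bar>cmod (a $ i)\<bar> * \<bar>cmod (b $ i)\<bar>)"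
    by (simp add: norm_mult)
  also have "\<dots> \<le> norm a * norm b"
    unfolding norm_vec_def by (rule L2_set_mult_ineq)
  finally show ?thesis .
qed

lemma norm_advection_term_le:
  "norm ((\<i> * cdot a (cvec k)) *s b) \<le> norm a * (norm k * norm b)"
  using mult_right_mono[OF norm_cdot_le[of a "cvec k"], of "norm b"]
  by (simp add: norm_smult_vec norm_mult mult.assoc)

lemma has_sum_Vnorm1_shift:
  assumes "L > 0" "v \<in> Vspace L 1"
  shows "((\<lambda>l. (norm (k - l) * norm (v (k - l)))\<^sup>2) has_sum (Vnorm L 1 v / L)\<^sup>2) UNIV"
proof -
  have "bij (\<lambda>l :: real^2. k - l)"
    by (rule bij_betw_byWitness[of _ "\<lambda>l. k - l"]) auto
  from has_sum_reindex_bij_betw[OF this, of "\<lambda>m. (norm m * norm (v m))\<^sup>2"] show ?thesis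
    using has_sum_Vnorm1[OF assms] by simp
qed

text \<open>Each term is split into two squares, and the spectral gap bounds |u_l| by a multiple of
  |l| |u_l|. Additivity of \<open>B\<close> rests on this, since \<open>infsum\<close> of a
  divergent family is 0.\<close>

lemma summable_on_advection:
  assumes "L > 0" "u \<in> Vspace L 1" "v \<in> Vspace L 1"
  shows "(\<lambda>l. (\<i> * cdot (u l) (cvec (k - l))) *s v (k - l)) summable_on wavevectors L"
proof (rule abs_summable_summable)
  define c where "c = (L / (2 * pi))\<^sup>2"
  have "(\<lambda>l. c * (norm l * norm (u l))\<^sup>2 + (norm (k - l) * norm (v (k - l)))\<^sup>2)
      summable_on UNIV"
    using has_sum_Vnorm1[OF assms(1,2)] has_sum_Vnorm1_shift[OF assms(1,3), of k]
    by (intro summable_on_add summable_on_cmult_right) (auto simp: summable_on_def)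
  then have "(\<lambda>l. c * (norm l * norm (u l))\<^sup>2 + (norm (k - l) * norm (v (k - l)))\<^sup>2)
      summable_on wavevectors L"
    by (rule summable_on_subset) auto
  then show "(\<lambda>l. norm ((\<i> * cdot (u l) (cvec (k - l))) *s v (k - l))) summable_on wavevectors L"
  proof (rule summable_on_comparison_test)
    fix l assume l: "l \<in> wavevectors L"
    define x where "x = norm (k - l) * norm (v (k - l))"
    have "norm ((\<i> * cdot (u l) (cvec (k - l))) *s v (k - l)) \<le> norm (u l) * x"
      unfolding x_def by (rule norm_advection_term_le)
    also have "\<dots> \<le> (norm (u l))\<^sup>2 + x\<^sup>2"
      using sum_squares_bound[of "norm (u l)" x] zero_le_power2[of "norm (u l)"]
        zero_le_power2[of x] by linarith
    also have "1 \<le> L / (2 * pi) * norm l"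
      using norm_wavevector_ge[OF assms(1) l] assms(1) by (simp add: field_simps)
    then have "1 * norm (u l) \<le> L / (2 * pi) * norm l * norm (u l)"
      by (rule mult_right_mono) auto
    then have "(norm (u l))\<^sup>2 \<le> (L / (2 * pi) * norm l * norm (u l))\<^sup>2"
      by (intro power_mono) auto
    finally show "norm ((\<i> * cdot (u l) (cvec (k - l))) *s v (k - l))
        \<le> c * (norm l * norm (u l))\<^sup>2 + (norm (k - l) * norm (v (k - l)))\<^sup>2"
      by (simp add: c_def x_def power_mult_distrib power_divide mult_ac add_mono)
  qed auto
qed

lemma leray_lincomb: "leray L (\<lambda>k. a *\<^sub>R u k + b *\<^sub>R v k) k = a *\<^sub>R leray L u k + b *\<^sub>R leray L v k"
proof -
  have "cdot (cvec k) (a *\<^sub>R u k + b *\<^sub>R v k) = a *\<^sub>R cdot (cvec k) (u k) + b *\<^sub>R cdot (cvec k) (v k)"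
    by (simp add: cdot_def sum_2 algebra_simps)
  then show ?thesis
    by (simp add: leray_def add_divide_distrib vec_eq_iff scaleR_conv_of_real[where 'a = complex]
        algebra_simps)
qed

lemma B_add_left:
  assumes "L > 0" "u \<in> Vspace L 1" "u' \<in> Vspace L 1" "v \<in> Vspace L 1"
  shows "B L (u + u') v k = B L u v k + B L u' v k"
proof -
  have "advection L (u + u') v = (\<lambda>k. advection L u v k + advection L u' v k)"
  proof
    fix k
    have "cdot (a + b) c = cdot a c + cdot b c" for a b c
      by (simp add: cdot_def sum_2 algebra_simps)
    then show "advection L (u + u') v k = advection L u v k + advection L u' v k"
      unfolding advection_def
      by (subst infsum_add[symmetric])
         (use summable_on_advection assms in \<open>auto simp: distrib_left vec_eq_iff algebra_simps intro!: infsum_cong\<close>)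
  qed
  then show ?thesis
    using leray_lincomb[of L 1 "advection L u v" 1 "advection L u' v" k] by (simp add: B_def)
qed

lemma B_add_right:
  assumes "L > 0" "u \<in> Vspace L 1" "v \<in> Vspace L 1" "v' \<in> Vspace L 1"
  shows "B L u (v + v') k = B L u v k + B L u v' k"
proof -
  have "advection L u (v + v') = (\<lambda>k. advection L u v k + advection L u v' k)"
  proof
    fix k
    show "advection L u (v + v') k = advection L u v k + advection L u v' k"
      unfolding advection_def
      by (subst infsum_add[symmetric])
         (use summable_on_advection assms in \<open>auto simp: vec_eq_iff algebra_simps intro!: infsum_cong\<close>)
  qed
  then show ?thesis
    using leray_lincomb[of L 1 "advection L u v" 1 "advection L u v'" k] by (simp add: B_def)
qed

text \<open>Expanding around v leaves v as the only coefficient. The nudged solution v is bounded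
  independently of \<delta>, while nothing uniform in \<delta> is known beforehand about the
  inserted solution u.\<close>

lemma B_diff:
  assumes "L > 0" "u \<in> Vspace L 1" "v \<in> Vspace L 1"
  shows "B L u u k - B L v v k = B L (u - v) (u - v) k + B L (u - v) v k + B L v (u - v) k"
proof -
  have w: "u - v \<in> Vspace L 1" using assms by (simp add: Vspace_diff)
  have "u = (u - v) + v" by simp
  then have "B L u u k = B L ((u - v) + v) ((u - v) + v) k" by simp
  also have "\<dots> = B L (u - v) (u - v) k + B L (u - v) v k + (B L v (u - v) k + B L v v k)"
    using assms w by (simp only: B_add_left B_add_right Vspace_add) (simp add: add_ac)
  finally show ?thesis by (simp add: add_ac)
qed

text \<open>The larger of the two numbers is replaced by the smaller. This decouples the weights of
  k and l in the convolution, leaving in each term one variable with the summable power -3.\<close>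

lemma inverse_mult_square_le:
  fixes a b :: real
  assumes "a > 0" "b > 0"
  shows "inverse a * inverse (b\<^sup>2) \<le> inverse (a ^ 3) + inverse (b ^ 3)"
proof (cases "a \<le> b")
  case True
  have "inverse a * inverse (b\<^sup>2) \<le> inverse a * inverse (a\<^sup>2)"
    using assms True by (intro mult_left_mono le_imp_inverse_le power_mono) auto
  also have "\<dots> = inverse (a ^ 3)" by (simp add: power3_eq_cube power2_eq_square)
  finally show ?thesis using assms by (simp add: add_increasing2)
next
  case False
  have "inverse a * inverse (b\<^sup>2) \<le> inverse b * inverse (b\<^sup>2)"
    using assms False by (intro mult_right_mono le_imp_inverse_le) auto
  also have "\<dots> = inverse (b ^ 3)" by (simp add: power3_eq_cube power2_eq_square)
  finally show ?thesis using assms by (simp add: add_increasing)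
qed

text \<open>Cauchy-Schwarz with the weight |l| extracts X and leaves the double sum of |k|^{-1}
  |l|^{-2} g(k - l)^2. After decoupling, one variable carries the power -3 and contributes Z, while
  the other runs through a shift of g and contributes Y; the two cases give the factor 2.\<close>

lemma convolution_bound:
  fixes a g :: "real^2 \<Rightarrow> real"
  assumes "finite F" "finite G" "0 \<notin> F" "0 \<notin> G"
    and X: "(\<Sum>l\<in>G. (norm l * a l)\<^sup>2) \<le> X"
    and Y: "\<And>M. finite M \<Longrightarrow> (\<Sum>m\<in>M. (g m)\<^sup>2) \<le> Y"
    and Z: "(\<Sum>k\<in>F. inverse (norm k ^ 3)) \<le> Z" "(\<Sum>k\<in>G. inverse (norm k ^ 3)) \<le> Z"
  shows "(\<Sum>k\<in>F. inverse (norm k) * (\<Sum>l\<in>G. a l * g (k - l))\<^sup>2) \<le> 2 * Z * X * Y"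
proof -
  have X0: "0 \<le> X" using X by (meson order_trans sum_nonneg zero_le_power2)
  have Y0: "0 \<le> Y" using Y[of "{}"] by simp
  have Yl: "(\<Sum>l\<in>G. (g (k - l))\<^sup>2) \<le> Y" for k
    using Y[of "(\<lambda>l. k - l) ` G"] assms(2) sum.reindex[of "\<lambda>l. k - l" G "\<lambda>m. (g m)\<^sup>2"]
    by (simp add: inj_on_def)
  have Yk: "(\<Sum>k\<in>F. (g (k - l))\<^sup>2) \<le> Y" for l
    using Y[of "(\<lambda>k. k - l) ` F"] assms(1) sum.reindex[of "\<lambda>k. k - l" F "\<lambda>m. (g m)\<^sup>2"]
    by (simp add: inj_on_def)
  have CS: "(\<Sum>l\<in>G. a l * g (k - l))\<^sup>2 \<le> X * (\<Sum>l\<in>G. inverse ((norm l)\<^sup>2) * (g (k - l))\<^sup>2)" for k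
  proof -
    have "(\<Sum>l\<in>G. a l * g (k - l)) = (\<Sum>l\<in>G. (norm l * a l) * (inverse (norm l) * g (k - l)))"
      using assms(4) by (intro sum.cong) (auto simp: field_simps)
    then have "(\<Sum>l\<in>G. a l * g (k - l))\<^sup>2
        \<le> (\<Sum>l\<in>G. (norm l * a l)\<^sup>2) * (\<Sum>l\<in>G. (inverse (norm l) * g (k - l))\<^sup>2)"
      by (simp add: Cauchy_Schwarz_ineq_sum)
    also have "\<dots> \<le> X * (\<Sum>l\<in>G. (inverse (norm l) * g (k - l))\<^sup>2)"
      by (intro mult_right_mono X sum_nonneg) auto
    finally show ?thesis by (simp add: power_mult_distrib power_inverse)
  qed
  have "(\<Sum>k\<in>F. inverse (norm k) * (\<Sum>l\<in>G. a l * g (k - l))\<^sup>2)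
      \<le> (\<Sum>k\<in>F. inverse (norm k) * (X * (\<Sum>l\<in>G. inverse ((norm l)\<^sup>2) * (g (k - l))\<^sup>2)))"
    by (intro sum_mono mult_left_mono CS) auto
  also have "\<dots> = X * (\<Sum>k\<in>F. \<Sum>l\<in>G. inverse (norm k) * inverse ((norm l)\<^sup>2) * (g (k - l))\<^sup>2)"
    by (simp add: sum_distrib_left mult_ac)
  also have "\<dots> \<le> X * (\<Sum>k\<in>F. \<Sum>l\<in>G.
      (inverse (norm k ^ 3) + inverse (norm l ^ 3)) * (g (k - l))\<^sup>2)"
    using assms(3,4)
    by (intro mult_left_mono sum_mono mult_right_mono X0 inverse_mult_square_le) auto
  also have "\<dots> = X * ((\<Sum>k\<in>F. inverse (norm k ^ 3) * (\<Sum>l\<in>G. (g (k - l))\<^sup>2))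
      + (\<Sum>l\<in>G. inverse (norm l ^ 3) * (\<Sum>k\<in>F. (g (k - l))\<^sup>2)))"
    by (simp add: distrib_right sum.distrib sum_distrib_left sum.swap[of _ F G])
  also have "\<dots> \<le> X * ((\<Sum>k\<in>F. inverse (norm k ^ 3) * Y) + (\<Sum>l\<in>G. inverse (norm l ^ 3) * Y))"
    by (intro mult_left_mono add_mono sum_mono X0 Yl Yk) auto
  also have "\<dots> \<le> X * (Z * Y + Z * Y)"
    unfolding sum_distrib_right[symmetric]
    by (intro mult_left_mono add_mono mult_right_mono Z X0 Y0)
  finally show ?thesis by (simp add: algebra_simps)
qed

text \<open>
  \<open>B\<close> maps \<open>V \<times> V\<close> into \<open>V\<^bsub>-1/2\<^esub>\<close>: the loss stays below one derivative, which makes the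
  heat-kernel singularity in \<open>B_pairing\<close> integrable.
\<close>

lemma B_bound:
  assumes "L > 0" "u \<in> Vspace L 1" "v \<in> Vspace L 1" "finite F"
  shows "(\<Sum>k\<in>F. inverse (norm k) * (norm (B L u v k))\<^sup>2)
    \<le> 2 * (\<Sum>\<^sub>\<infinity>k\<in>wavevectors L. inverse (norm k ^ 3)) * (Vnorm L 1 u / L)\<^sup>2 * (Vnorm L 1 v / L)\<^sup>2"
    (is "_ \<le> ?R")
proof -
  let ?W = "wavevectors L"
  define T where "T k l = (\<i> * cdot (u l) (cvec (k - l))) *s v (k - l)" for k l
  have 0: "0 \<notin> ?W" by (rule wavevectors_nonzero[OF assms(1)])
  have "(\<Sum>k\<in>F. inverse (norm k) * (norm (B L u v k))\<^sup>2)
      = (\<Sum>k\<in>F \<inter> ?W. inverse (norm k) * (norm (B L u v k))\<^sup>2)"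
    using assms(4) by (intro sum.mono_neutral_right) (auto simp: B_def leray_def)
  also have "\<dots> \<le> (\<Sum>k\<in>F \<inter> ?W. inverse (norm k) * (norm (advection L u v k))\<^sup>2)"
    unfolding B_def
    by (intro sum_mono mult_left_mono power_mono norm_leray_le assms(1)) auto
  \<comment> \<open>Each advection coefficient is a limit of sums over finite sets G. The bound on
    these is uniform in G, hence survives the limit while F stays fixed.\<close>
  also have "\<dots> \<le> ?R"
  proof (rule tendsto_upperbound)
    have "((\<lambda>G. sum (T k) G) \<longlongrightarrow> advection L u v k) (finite_subsets_at_top ?W)" for k
      unfolding advection_def T_def by (intro infsum_tendsto summable_on_advection assms)
    then show "((\<lambda>G. \<Sum>k\<in>F \<inter> ?W. inverse (norm k) * (norm (sum (T k) G))\<^sup>2)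
        \<longlongrightarrow> (\<Sum>k\<in>F \<inter> ?W. inverse (norm k) * (norm (advection L u v k))\<^sup>2))
        (finite_subsets_at_top ?W)"
      by (intro tendsto_intros)
    have "(\<Sum>k\<in>F \<inter> ?W. inverse (norm k) * (norm (sum (T k) G))\<^sup>2) \<le> ?R"
      if G: "finite G" "G \<subseteq> ?W" for G
    proof -
      have "(\<Sum>k\<in>F \<inter> ?W. inverse (norm k) * (norm (sum (T k) G))\<^sup>2) \<le>
        (\<Sum>k\<in>F \<inter> ?W. inverse (norm k) *
          (\<Sum>l\<in>G. norm (u l) * (\<lambda>m. norm m * norm (v m)) (k - l))\<^sup>2)"
        unfolding T_def
        by (intro sum_mono mult_left_mono power_mono sum_norm_le norm_advection_term_le) auto
      also have "\<dots> \<le> ?R"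
      proof (rule convolution_bound)
        show "(\<Sum>l\<in>G. (norm l * norm (u l))\<^sup>2) \<le> (Vnorm L 1 u / L)\<^sup>2"
          by (rule finite_sum_le_has_sum[OF has_sum_Vnorm1[OF assms(1,2)] G(1)]) auto
        show "(\<Sum>m\<in>M. (norm m * norm (v m))\<^sup>2) \<le> (Vnorm L 1 v / L)\<^sup>2" if "finite M" for M
          by (rule finite_sum_le_has_sum[OF has_sum_Vnorm1[OF assms(1,3)] that]) auto
        show "(\<Sum>k\<in>F \<inter> ?W. inverse (norm k ^ 3)) \<le> (\<Sum>\<^sub>\<infinity>k\<in>?W. inverse (norm k ^ 3))"
          and "(\<Sum>k\<in>G. inverse (norm k ^ 3)) \<le> (\<Sum>\<^sub>\<infinity>k\<in>?W. inverse (norm k ^ 3))"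
          using assms(4) G
          by (auto intro!: finite_sum_le_infsum summable_on_norm_inverse_cube assms(1))
      qed (use assms(4) G 0 in auto)
      finally show ?thesis .
    qed
    then show "\<forall>\<^sub>F G in finite_subsets_at_top ?W.
        (\<Sum>k\<in>F \<inter> ?W. inverse (norm k) * (norm (sum (T k) G))\<^sup>2) \<le> ?R"
      by (auto simp: eventually_finite_subsets_at_top)
  qed auto
  finally show ?thesis .
qed

section \<open>Heat-kernel smoothing and the dual pairing\<close>

lemma powr_le_exp:
  fixes x a :: real
  assumes "0 < x" "0 \<le> a" "a \<le> 1"
  shows "x powr a \<le> exp x"
proof (cases "x \<le> 1")
  case True
  then have "x powr a \<le> 1" using assms by (simp add: powr_le1)
  also have "1 \<le> exp x" using assms by simp
  finally show ?thesis .
next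
  case False
  then have "x powr a \<le> x powr 1" using assms by (intro powr_mono) auto
  also have "\<dots> \<le> exp x"
    using assms exp_ge_add_one_self[of x] by (simp del: exp_ge_add_one_self)
  finally show ?thesis .
qed

text \<open>In the variable y = c x^2 this is y^{3/4} e^{-y} <= 1, because x times its square root
  is (x^2)^{3/4}. With x = |k| and c = \<nu> r it is the smoothing estimate for one mode.\<close>

lemma heat_kernel_bound:
  fixes x c :: real
  assumes "x > 0" "c > 0"
  shows "x * exp (- (c * x\<^sup>2)) \<le> c powr (-3/4) * sqrt (inverse x)"
proof -
  define y where "y = c * x\<^sup>2"
  have y: "y > 0" using assms by (simp add: y_def)
  have "y powr (3/4) \<le> exp y"
    using y by (intro powr_le_exp) auto
  then have *: "y powr (3/4) * exp (- y) \<le> 1"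
    by (simp add: exp_minus field_simps)
  have "y powr (3/4) = c powr (3/4) * (x powr 2) powr (3/4)"
    unfolding y_def using assms by (simp add: powr_mult)
  also have "(x powr 2) powr (3/4) = x * sqrt x"
    using assms powr_add[of x 1 "1/2"] by (simp add: powr_powr powr_half_sqrt del: powr_numeral)
  finally have "x * exp (- y) * (c powr (3/4) * sqrt x) \<le> 1"
    using * by (simp add: mult_ac)
  moreover have "c powr (-3/4) * sqrt (inverse x) = 1 / (c powr (3/4) * sqrt x)"
    using powr_minus_divide[of c "3/4"] by (simp add: real_sqrt_divide inverse_eq_divide)
  ultimately show ?thesis
    using assms by (simp add: y_def[symmetric] pos_le_divide_eq)
qed

text \<open>The inner product of V cut down to the modes in \<open>F\<close>, without the factor
  L^2; \<open>Vnorm1_le\<close> restores the factor L in the norm. For finite \<open>F\<close> it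
  can be differentiated in time term by term.\<close>

definition inner1 :: "(real^2) set \<Rightarrow> series \<Rightarrow> series \<Rightarrow> real" where
  "inner1 F p q = (\<Sum>k\<in>F. (norm k)\<^sup>2 * inner (p k) (q k))"

definition norm1 :: "(real^2) set \<Rightarrow> series \<Rightarrow> real" where
  "norm1 F p = L2_set (\<lambda>k. norm k * norm (p k)) F"

definition heat :: "real \<Rightarrow> real \<Rightarrow> series \<Rightarrow> series" where
  "heat \<nu> r q = (\<lambda>k. exp (- (\<nu> * r * (norm k)\<^sup>2)) *\<^sub>R q k)"

text \<open>One of the two powers of |k| in the pairing goes to p. The other, together with the
  |k|^{1/2} by which \<open>B\<close> misses square summability, is paid for by the heat factor at
  the price r^{-3/4}. The constant depends neither on p nor on F.\<close>

lemma B_pairing: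
  assumes "L > 0" "\<nu> > 0"
  obtains C where "C \<ge> 0"
    and "\<And>r F p u v. \<lbrakk>r > 0; finite F; u \<in> Vspace L 1; v \<in> Vspace L 1\<rbrakk> \<Longrightarrow>
      \<bar>inner1 F p (heat \<nu> r (B L u v))\<bar>
      \<le> C * r powr (-3/4) * norm1 F p * (Vnorm L 1 u * Vnorm L 1 v)"
proof -
  define Z where "Z = (\<Sum>\<^sub>\<infinity>k\<in>wavevectors L. inverse (norm k ^ 3))"
  have Z0: "Z \<ge> 0" by (simp add: Z_def infsum_nonneg)
  define C where "C = \<nu> powr (-3/4) * (sqrt (2 * Z) / L\<^sup>2)"
  have "\<bar>inner1 F p (heat \<nu> r (B L u v))\<bar>
      \<le> C * r powr (-3/4) * norm1 F p * (Vnorm L 1 u * Vnorm L 1 v)"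
    if "r > 0" "finite F" "u \<in> Vspace L 1" "v \<in> Vspace L 1" for r F p u v
  proof -
    let ?b = "\<lambda>k. sqrt (inverse (norm k)) * norm (B L u v k)"
    let ?c = "(\<nu> * r) powr (-3/4)"
    have "\<bar>inner1 F p (heat \<nu> r (B L u v))\<bar>
        \<le> (\<Sum>k\<in>F. ?c * (\<bar>norm k * norm (p k)\<bar> * \<bar>?b k\<bar>))"
      unfolding inner1_def
    proof (rule order_trans[OF sum_abs sum_mono])
      fix k
      show "\<bar>(norm k)\<^sup>2 * inner (p k) (heat \<nu> r (B L u v) k)\<bar>
          \<le> ?c * (\<bar>norm k * norm (p k)\<bar> * \<bar>?b k\<bar>)"
      proof (cases "k = 0")
        case False
        have "\<bar>inner (p k) (B L u v k)\<bar> \<le> norm (p k) * norm (B L u v k)"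
          by (rule Cauchy_Schwarz_ineq2)
        then have "\<bar>(norm k)\<^sup>2 * inner (p k) (heat \<nu> r (B L u v) k)\<bar>
            \<le> (norm k)\<^sup>2 * exp (- (\<nu> * r * (norm k)\<^sup>2)) * (norm (p k) * norm (B L u v k))"
          by (simp add: heat_def abs_mult mult.assoc mult_left_mono)
        also have "\<dots> = (norm k * exp (- (\<nu> * r * (norm k)\<^sup>2)))
            * (norm k * norm (p k) * norm (B L u v k))"
          by (simp add: power2_eq_square)
        also have "\<dots> \<le> (?c * sqrt (inverse (norm k))) * (norm k * norm (p k) * norm (B L u v k))"
          using False assms that(1) by (intro mult_right_mono heat_kernel_bound) auto
        finally show ?thesis by (simp add: mult_ac)
      qed simp
    qed
    also have "\<dots> \<le> ?c * (norm1 F p * L2_set ?b F)"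
      unfolding sum_distrib_left[symmetric] norm1_def
      by (intro mult_left_mono L2_set_mult_ineq) auto
    also have "\<dots> \<le> ?c * (norm1 F p *
        (sqrt (2 * Z) * (Vnorm L 1 u / L) * (Vnorm L 1 v / L)))"
    proof (intro mult_left_mono)
      have "(\<Sum>k\<in>F. (?b k)\<^sup>2) = (\<Sum>k\<in>F. inverse (norm k) * (norm (B L u v k))\<^sup>2)"
        by (simp add: power_mult_distrib)
      also have "\<dots> \<le> 2 * Z * (Vnorm L 1 u / L)\<^sup>2 * (Vnorm L 1 v / L)\<^sup>2"
        unfolding Z_def using B_bound[OF assms(1) that(3,4,2)] .
      finally show "L2_set ?b F \<le> sqrt (2 * Z) * (Vnorm L 1 u / L) * (Vnorm L 1 v / L)"
        using Z0 assms(1) Vnorm_nonneg unfolding L2_set_def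
        by (intro real_le_lsqrt) (auto simp: power_mult_distrib power_divide)
    qed (auto simp: norm1_def)
    also have "\<dots> = C * r powr (-3/4) * norm1 F p
        * (Vnorm L 1 u * Vnorm L 1 v)"
      unfolding C_def powr_mult by (simp add: power2_eq_square)
    finally show ?thesis .
  qed
  moreover have "C \<ge> 0" using Z0 by (simp add: C_def)
  ultimately show thesis using that by blast
qed

section \<open>Solutions in Fourier variables\<close>

text \<open>For a fixed wave vector the weight \<open>c\<close> is a positive constant, so even
  convergence in the dual space controls a single mode. Off the lattice \<open>w s\<close> and
  \<open>l\<close> eventually agree, since their difference lies in \<open>Vspace\<close>.\<close>

lemma Vtendsto_coeff:
  assumes "L > 0" "Vtendsto L \<alpha> w l F"
  shows "((\<lambda>s. w s k) \<longlongrightarrow> l k) F"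
proof (cases "k \<in> wavevectors L")
  case True
  have ev: "\<forall>\<^sub>F s in F. w s - l \<in> Vspace L \<alpha>" and lim: "((\<lambda>s. Vnorm L \<alpha> (w s - l)) \<longlongrightarrow> 0) F"
    using assms(2) by (auto simp: Vtendsto_def)
  define c where "c = L * norm k powr \<alpha>"
  have "norm k > 0" using True wavevectors_nonzero[OF assms(1)] by auto
  then have c: "c > 0" using assms(1) by (simp add: c_def)
  have "((\<lambda>s. w s k - l k) \<longlongrightarrow> 0) F"
  proof (rule Lim_null_comparison)
    show "\<forall>\<^sub>F s in F. norm (w s k - l k) \<le> Vnorm L \<alpha> (w s - l) / c"
      using ev
    proof eventually_elim
      case (elim s)
      have "c * norm ((w s - l) k) \<le> Vnorm L \<alpha> (w s - l)"
        unfolding c_def using elim by (intro norm_coeff_le_Vnorm assms(1)) (auto simp: Vspace_def)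
      then show ?case using c by (simp add: field_simps)
    qed
    show "((\<lambda>s. Vnorm L \<alpha> (w s - l) / c) \<longlongrightarrow> 0) F"
      using tendsto_divide[OF lim tendsto_const[of c]] c by simp
  qed
  then show ?thesis by (rule LIM_zero_cancel)
next
  case False
  then have "\<forall>\<^sub>F s in F. w s k = l k"
    using assms(2) unfolding Vtendsto_def
    by (auto elim!: eventually_mono dest: Vspace_zero_off)
  then show ?thesis by (rule tendsto_eventually)
qed

lemma ns_solution_in_Vspace: "ns_solution L \<nu> g a w \<Longrightarrow> a \<le> t \<Longrightarrow> w t \<in> Vspace L 1"
  by (simp add: ns_solution_def)

lemma ns_solution_coeff_continuous:
  assumes "L > 0" "ns_solution L \<nu> g a w"
  shows "continuous_on {a..} (\<lambda>t. w t k)"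
  unfolding continuous_on_def
proof
  fix t assume "t \<in> {a..}"
  then have "Vtendsto L 1 w (w t) (at t within {a..})"
    using assms(2) by (simp add: ns_solution_def)
  then show "((\<lambda>t. w t k) \<longlongrightarrow> w t k) (at t within {a..})"
    by (rule Vtendsto_coeff[OF assms(1)])
qed

lemma ns_solution_Vtendsto:
  assumes "ns_solution L \<nu> g a w" "a \<le> t"
  shows "((\<lambda>s. Vnorm L 1 (w s - w t)) \<longlongrightarrow> 0) (at t within {a..})"
  using assms by (auto simp: ns_solution_def Vtendsto_def)

text \<open>The equation in the dual space, read mode by mode, consists of ordinary differential
  equations. Strictness of \<open>a < t\<close> turns the one-sided difference quotient into a
  two-sided one.\<close>

lemma ns_solution_coeff_derivative:
  assumes "L > 0" "ns_solution L \<nu> g a w" "a < t"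
  shows "((\<lambda>t. w t k) has_vector_derivative
    g t k - (\<nu> * (norm k)\<^sup>2) *\<^sub>R w t k - B L (w t) (w t) k) (at t)"
proof -
  let ?D = "g t k - (\<nu> * (norm k)\<^sup>2) *\<^sub>R w t k - B L (w t) (w t) k"
  have "Vtendsto L (- 1) (\<lambda>s. (1 / (s - t)) \<cdot>\<^sub>S (w s - w t))
      (g t - \<nu> \<cdot>\<^sub>S stokes (w t) - B L (w t) (w t)) (at t within {a..})"
    using assms by (auto simp: ns_solution_def)
  from Vtendsto_coeff[OF assms(1) this, of k]
  have "((\<lambda>s. (1 / (s - t)) *\<^sub>R (w s k - w t k)) \<longlongrightarrow> ?D) (at t within {a..})"
    by (simp add: stokes_def)
  moreover have "at t within {a..} = at t"
    using assms(3) by (intro at_within_interior) auto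
  ultimately have "((\<lambda>s. (1 / (s - t)) *\<^sub>R (w s k - w t k) - ?D) \<longlongrightarrow> 0) (at t)"
    by (simp add: LIM_zero)
  then have lim: "((\<lambda>s. norm ((1 / (s - t)) *\<^sub>R (w s k - w t k) - ?D)) \<longlongrightarrow> 0) (at t)"
    by (rule tendsto_norm_zero)
  have eq: "norm ((1 / (s - t)) *\<^sub>R (w s k - w t k) - ?D)
      = norm ((1 / norm (s - t)) *\<^sub>R (w s k - (w t k + (s - t) *\<^sub>R ?D)))" if "s \<noteq> t" for s
  proof -
    have "(1 / (s - t)) *\<^sub>R (w s k - w t k) - ?D = (1 / (s - t)) *\<^sub>R (w s k - (w t k + (s - t) *\<^sub>R ?D))"
      using that by (simp add: scaleR_diff_right scaleR_add_right)
    then show ?thesis by simp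
  qed
  have lim': "((\<lambda>s. norm ((1 / norm (s - t)) *\<^sub>R (w s k - (w t k + (s - t) *\<^sub>R ?D)))) \<longlongrightarrow> 0) (at t)"
    by (rule Lim_transform_eventually[OF lim]) (use eq in \<open>auto simp: eventually_at_filter\<close>)
  show ?thesis
    unfolding has_vector_derivative_def has_derivative_within
    by (intro conjI bounded_linear_scaleR_left tendsto_norm_zero_cancel[OF lim'])
qed

text \<open>The shift \<open>c\<close> reconciles two clocks: runs of the semigroup start at time 0,
  while the nudged solution lives in absolute time.\<close>

lemma ns_solution_Vnorm_continuous:
  assumes "L > 0" "ns_solution L \<nu> g a w" "ns_solution L \<nu>' g' b w'" "S \<subseteq> {b..}" "\<And>t. t \<in> S \<Longrightarrow> a \<le> t + c"
  shows "continuous_on S (\<lambda>t. Vnorm L 1 (w (t + c) - w' t))"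
  unfolding continuous_on_def
proof
  fix t assume t: "t \<in> S"
  have "filterlim (\<lambda>s. s + c) (at (t + c) within {a..}) (at t within S)"
    unfolding filterlim_at
  proof
    show "\<forall>\<^sub>F s in at t within S. s + c \<in> {a..} \<and> s + c \<noteq> t + c"
      using assms(5) by (auto simp: eventually_at intro!: exI[of _ 1])
    show "((\<lambda>s. s + c) \<longlongrightarrow> t + c) (at t within S)"
      by (intro tendsto_intros)
  qed
  from filterlim_compose[OF ns_solution_Vtendsto[OF assms(2) assms(5)[OF t]] this]
  have 1: "((\<lambda>s. Vnorm L 1 (w (s + c) - w (t + c))) \<longlongrightarrow> 0) (at t within S)" .
  have 2: "((\<lambda>s. Vnorm L 1 (w' s - w' t)) \<longlongrightarrow> 0) (at t within S)"
    using ns_solution_Vtendsto[OF assms(3)] t assms(4) by (auto intro: tendsto_within_subset)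
  have "((\<lambda>s. Vnorm L 1 (w (s + c) - w' s) - Vnorm L 1 (w (t + c) - w' t)) \<longlongrightarrow> 0) (at t within S)"
  proof (rule Lim_null_comparison)
    show "((\<lambda>s. Vnorm L 1 (w (s + c) - w (t + c)) + Vnorm L 1 (w' s - w' t)) \<longlongrightarrow> 0) (at t within S)"
      using tendsto_add[OF 1 2] by simp
    have "norm (Vnorm L 1 (w (s + c) - w' s) - Vnorm L 1 (w (t + c) - w' t))
        \<le> Vnorm L 1 (w (s + c) - w (t + c)) + Vnorm L 1 (w' s - w' t)" if s: "s \<in> S" for s
    proof -
      have V: "w (s + c) \<in> Vspace L 1" "w (t + c) \<in> Vspace L 1" "w' s \<in> Vspace L 1" "w' t \<in> Vspace L 1"
        using assms s t by (auto intro!: ns_solution_in_Vspace)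
      have "\<bar>Vnorm L 1 (w (s + c) - w' s) - Vnorm L 1 (w (t + c) - w' t)\<bar>
          \<le> Vnorm L 1 ((w (s + c) - w' s) - (w (t + c) - w' t))"
        using V by (intro abs_Vnorm1_diff_le assms(1) Vspace_diff)
      also have "(w (s + c) - w' s) - (w (t + c) - w' t) = (w (s + c) - w (t + c)) - (w' s - w' t)"
        by simp
      also have "Vnorm L 1 \<dots> \<le> Vnorm L 1 (w (s + c) - w (t + c)) + Vnorm L 1 (w' s - w' t)"
        using V by (intro Vnorm1_diff_le assms(1) Vspace_diff)
      finally show ?thesis by (simp only: real_norm_def)
    qed
    then show "\<forall>\<^sub>F s in at t within S. norm (Vnorm L 1 (w (s + c) - w' s) - Vnorm L 1 (w (t + c) - w' t))
        \<le> Vnorm L 1 (w (s + c) - w (t + c)) + Vnorm L 1 (w' s - w' t)"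
      by (auto simp: eventually_at_filter)
  qed
  then show "((\<lambda>s. Vnorm L 1 (w (s + c) - w' s)) \<longlongrightarrow> Vnorm L 1 (w (t + c) - w' t)) (at t within S)"
    by (rule LIM_zero_cancel)
qed

lemma ns_solution_Vnorm1_continuous:
  assumes "L > 0" "ns_solution L \<nu> g a w"
  shows "continuous_on {a..} (\<lambda>t. Vnorm L 1 (w t))"
  unfolding continuous_on_def
proof
  fix t assume t: "t \<in> {a..}"
  have "((\<lambda>s. Vnorm L 1 (w s) - Vnorm L 1 (w t)) \<longlongrightarrow> 0) (at t within {a..})"
  proof (rule Lim_null_comparison)
    show "((\<lambda>s. Vnorm L 1 (w s - w t)) \<longlongrightarrow> 0) (at t within {a..})"
      using ns_solution_Vtendsto[OF assms(2)] t by simp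
    show "\<forall>\<^sub>F s in at t within {a..}. norm (Vnorm L 1 (w s) - Vnorm L 1 (w t)) \<le> Vnorm L 1 (w s - w t)"
      using t assms
      by (auto simp: eventually_at intro!: exI[of _ 1] abs_Vnorm1_diff_le ns_solution_in_Vspace)
  qed
  then show "((\<lambda>s. Vnorm L 1 (w s)) \<longlongrightarrow> Vnorm L 1 (w t)) (at t within {a..})"
    by (rule LIM_zero_cancel)
qed

section \<open>Testing the mild formulation\<close>

lemma heat_0 [simp]: "heat \<nu> 0 q = q"
  by (simp add: heat_def)

lemma heat_add: "heat \<nu> r (p + q) = heat \<nu> r p + heat \<nu> r q"
  and heat_diff: "heat \<nu> r (p - q) = heat \<nu> r p - heat \<nu> r q"
  and heat_smul: "heat \<nu> r (c \<cdot>\<^sub>S p) = c \<cdot>\<^sub>S heat \<nu> r p"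
  by (simp_all add: heat_def fun_eq_iff algebra_simps)

lemma inner1_add: "inner1 F p (q + q') = inner1 F p q + inner1 F p q'"
  and inner1_diff: "inner1 F p (q - q') = inner1 F p q - inner1 F p q'"
  and inner1_smul: "inner1 F p (c \<cdot>\<^sub>S q) = c * inner1 F p q"
  by (simp_all add: inner1_def inner_add_right inner_diff_right algebra_simps sum.distrib
      sum_subtractf sum_distrib_left)

lemma norm1_nonneg: "0 \<le> norm1 F p"
  by (simp add: norm1_def)

lemma inner1_self: "inner1 F p p = (norm1 F p)\<^sup>2"
  by (simp add: inner1_def norm1_def L2_set_def power2_norm_eq_inner power_mult_distrib sum_nonneg)

lemma abs_inner1_le: "\<bar>inner1 F p q\<bar> \<le> norm1 F p * norm1 F q"
proof -
  have "\<bar>inner1 F p q\<bar> \<le> (\<Sum>k\<in>F. \<bar>norm k * norm (p k)\<bar> * \<bar>norm k * norm (q k)\<bar>)"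
    unfolding inner1_def
  proof (rule order_trans[OF sum_abs sum_mono])
    fix k
    show "\<bar>(norm k)\<^sup>2 * inner (p k) (q k)\<bar> \<le> \<bar>norm k * norm (p k)\<bar> * \<bar>norm k * norm (q k)\<bar>"
      using mult_left_mono[OF Cauchy_Schwarz_ineq2[of "p k" "q k"], of "(norm k)\<^sup>2"]
      by (simp add: abs_mult power2_eq_square mult_ac)
  qed
  also have "\<dots> \<le> norm1 F p * norm1 F q"
    unfolding norm1_def by (rule L2_set_mult_ineq)
  finally show ?thesis .
qed

lemma norm1_heat_le:
  assumes "0 \<le> \<nu>" "0 \<le> r"
  shows "norm1 F (heat \<nu> r q) \<le> norm1 F q"
  unfolding norm1_def heat_def using assms
  by (intro L2_set_mono) (auto intro!: mult_left_mono mult_left_le_one_le)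

text \<open>The right-hand side does not involve \<open>F\<close>: this is how the finite range of
  the observation operator gives bounds uniform in the modes tested.\<close>

lemma norm1_le_sum:
  assumes "finite K" "\<And>k. k \<notin> K \<Longrightarrow> q k = 0"
  shows "norm1 F q \<le> (\<Sum>k\<in>K. norm k * norm (q k))"
proof (cases "finite F")
  case True
  have "norm1 F q \<le> (\<Sum>k\<in>F. norm k * norm (q k))"
    unfolding norm1_def by (rule L2_set_le_sum) auto
  also have "\<dots> = (\<Sum>k\<in>F \<inter> K. norm k * norm (q k))"
    using True assms(2) by (intro sum.mono_neutral_right) auto
  also have "\<dots> \<le> (\<Sum>k\<in>K. norm k * norm (q k))"
    using assms(1) by (intro sum_mono2) auto
  finally show ?thesis .
qed (simp add: norm1_def sum_nonneg)

text \<open>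
  The derivative of \<open>\<tau> \<mapsto> heat (s - \<tau>) (u \<tau> - v \<tau>)\<close> contains neither Stokes operator, so
  that no regularity beyond \<open>V\<close> enters.
\<close>

lemma inner1_heat_difference_derivative:
  assumes "L > 0" "ns_solution L \<nu> g a u" "ns_solution L \<nu> g' b v" "a < \<tau> + c" "b < \<tau>"
  shows "((\<lambda>\<tau>. inner1 F p (heat \<nu> (s - \<tau>) (u (\<tau> + c) - v \<tau>))) has_real_derivative
    inner1 F p (heat \<nu> (s - \<tau>) (g (\<tau> + c) - g' \<tau> - (B L (u (\<tau> + c)) (u (\<tau> + c)) - B L (v \<tau>) (v \<tau>))))) (at \<tau>)"
proof -
  have *: "((\<lambda>\<tau>. inner (p k) (exp (- (\<nu> * (s - \<tau>) * (norm k)\<^sup>2)) *\<^sub>R (u (\<tau> + c) k - v \<tau> k)))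
    has_real_derivative inner (p k) (exp (- (\<nu> * (s - \<tau>) * (norm k)\<^sup>2)) *\<^sub>R
      (g (\<tau> + c) k - g' \<tau> k - (B L (u (\<tau> + c)) (u (\<tau> + c)) k - B L (v \<tau>) (v \<tau>) k)))) (at \<tau>)" for k
  proof -
    have "((\<lambda>\<tau>. \<tau> + c) has_vector_derivative 1) (at \<tau>)"
      by (auto simp: has_real_derivative_iff_has_vector_derivative[symmetric] intro!: derivative_eq_intros)
    from vector_diff_chain_at[OF this ns_solution_coeff_derivative[OF assms(1,2,4), of k]]
    have "((\<lambda>\<tau>. u (\<tau> + c) k) has_vector_derivative
        (g (\<tau> + c) k - (\<nu> * (norm k)\<^sup>2) *\<^sub>R u (\<tau> + c) k - B L (u (\<tau> + c)) (u (\<tau> + c)) k)) (at \<tau>)"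
      by (simp add: o_def)
    moreover note ns_solution_coeff_derivative[OF assms(1,3,5), of k]
    \<comment> \<open>Time enters the exponent through s - \<tau>, so the derivative carries the
      factor +\<nu> |k|^2 and cancels the dissipation of both solutions.\<close>
    moreover have "((\<lambda>\<tau>. exp (- (\<nu> * (s - \<tau>) * (norm k)\<^sup>2))) has_real_derivative
        exp (- (\<nu> * (s - \<tau>) * (norm k)\<^sup>2)) * (\<nu> * (norm k)\<^sup>2)) (at \<tau>)"
      by (auto intro!: derivative_eq_intros)
    ultimately have "((\<lambda>\<tau>. exp (- (\<nu> * (s - \<tau>) * (norm k)\<^sup>2)) *\<^sub>R (u (\<tau> + c) k - v \<tau> k))
      has_vector_derivative exp (- (\<nu> * (s - \<tau>) * (norm k)\<^sup>2)) *\<^sub>R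
      ((g (\<tau> + c) k - (\<nu> * (norm k)\<^sup>2) *\<^sub>R u (\<tau> + c) k - B L (u (\<tau> + c)) (u (\<tau> + c)) k)
        - (g' \<tau> k - (\<nu> * (norm k)\<^sup>2) *\<^sub>R v \<tau> k - B L (v \<tau>) (v \<tau>) k))
      + (exp (- (\<nu> * (s - \<tau>) * (norm k)\<^sup>2)) * (\<nu> * (norm k)\<^sup>2)) *\<^sub>R (u (\<tau> + c) k - v \<tau> k)) (at \<tau>)"
      by (intro has_vector_derivative_scaleR has_vector_derivative_diff)
    then have "((\<lambda>\<tau>. exp (- (\<nu> * (s - \<tau>) * (norm k)\<^sup>2)) *\<^sub>R (u (\<tau> + c) k - v \<tau> k))
      has_vector_derivative exp (- (\<nu> * (s - \<tau>) * (norm k)\<^sup>2)) *\<^sub>R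
      (g (\<tau> + c) k - g' \<tau> k - (B L (u (\<tau> + c)) (u (\<tau> + c)) k - B L (v \<tau>) (v \<tau>) k))) (at \<tau>)"
      by (simp add: algebra_simps)
    from bounded_linear.has_vector_derivative[OF bounded_linear_inner_right this, of "p k"]
    show ?thesis
      by (simp add: has_real_derivative_iff_has_vector_derivative)
  qed
  show ?thesis
    unfolding inner1_def heat_def
    by (intro DERIV_sum DERIV_cmult) (use * in simp)
qed

lemma inner1_heat_difference_continuous:
  assumes "L > 0" "ns_solution L \<nu> g a u" "ns_solution L \<nu> g' b v" "S \<subseteq> {b..}" "\<And>t. t \<in> S \<Longrightarrow> a \<le> t + c"
  shows "continuous_on S (\<lambda>\<tau>. inner1 F p (heat \<nu> (s - \<tau>) (u (\<tau> + c) - v \<tau>)))"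
proof -
  have [continuous_intros]: "continuous_on S (\<lambda>\<tau>. u (\<tau> + c) k)" "continuous_on S (\<lambda>\<tau>. v \<tau> k)" for k
    using ns_solution_coeff_continuous[OF assms(1,3), of k] assms(4,5)
    by (auto intro!: continuous_on_compose2[OF ns_solution_coeff_continuous[OF assms(1,2)]]
        continuous_intros intro: continuous_on_subset)
  show ?thesis
    unfolding inner1_def heat_def by (auto intro!: continuous_intros)
qed

text \<open>An extra singularity r^{-1/8} is accepted in exchange for the factor \<beta>^{-1/8}. The
  exponent rises from 3/4 to 7/8, still below 1, and a large \<beta> makes the Gronwall constant
  small.\<close>

lemma powr_exp_le:
  fixes r \<beta> :: real
  assumes "r > 0" "\<beta> > 0"
  shows "r powr (-3/4) * exp (- (\<beta> * r)) \<le> \<beta> powr (-1/8) * r powr (-7/8)"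
proof -
  have "(\<beta> * r) powr (1/8) \<le> exp (\<beta> * r)"
    using assms by (intro powr_le_exp) auto
  then have "inverse (exp (\<beta> * r)) \<le> inverse ((\<beta> * r) powr (1/8))"
    using assms by (intro le_imp_inverse_le) auto
  also have "\<dots> = \<beta> powr (-1/8) * r powr (-1/8)"
    by (simp add: powr_mult powr_minus)
  finally have "r powr (-3/4) * exp (- (\<beta> * r)) \<le> r powr (-3/4) * (\<beta> powr (-1/8) * r powr (-1/8))"
    by (intro mult_left_mono) (auto simp: exp_minus)
  also have "\<dots> = \<beta> powr (-1/8) * r powr (-7/8)"
    by (simp add: powr_add[symmetric] mult_ac)
  finally show ?thesis .
qed

text \<open>A primitive of (s - \<tau>)^{-7/8} is -8 (s - \<tau>)^{1/8}, whence the 8. Subtracting a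
  primitive of the bound leaves a function with nonpositive derivative, so the derivative of \<phi>
  is never integrated. The case b = s is included: the primitive is continuous there although its
  derivative blows up.\<close>

lemma nonincreasing_from_singular_derivative:
  fixes \<phi> \<phi>' :: "real \<Rightarrow> real"
  assumes "a \<le> b" "b \<le> s" "continuous_on {a..b} \<phi>"
    and "\<And>\<tau>. a < \<tau> \<Longrightarrow> \<tau> < b \<Longrightarrow> (\<phi> has_real_derivative \<phi>' \<tau>) (at \<tau>)"
    and "\<And>\<tau>. a < \<tau> \<Longrightarrow> \<tau> < b \<Longrightarrow> \<phi>' \<tau> \<le> A + K * (s - \<tau>) powr (-7/8)"
  shows "\<phi> b \<le> \<phi> a + A * (b - a) + 8 * K * ((s - a) powr (1/8) - (s - b) powr (1/8))"
proof -
  define \<psi> where "\<psi> \<tau> = \<phi> \<tau> - A * \<tau> + 8 * K * (s - \<tau>) powr (1/8)" for \<tau>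
  have "\<psi> b \<le> \<psi> a"
  proof (rule DERIV_nonpos_imp_decreasing_open[of a b \<psi>])
    show "a \<le> b" by (rule assms(1))
    show "continuous_on {a..b} \<psi>"
      unfolding \<psi>_def using assms(2) by (intro continuous_intros continuous_on_powr' assms(3)) auto
    fix \<tau> assume \<tau>: "a < \<tau>" "\<tau> < b"
    have "((\<lambda>\<tau>. (s - \<tau>) powr (1/8)) has_real_derivative - (1/8) * (s - \<tau>) powr (-7/8)) (at \<tau>)"
      using \<tau> assms(2) by (auto intro!: derivative_eq_intros)
    then have "(\<psi> has_real_derivative \<phi>' \<tau> - A + 8 * K * (- (1/8) * (s - \<tau>) powr (-7/8))) (at \<tau>)"
      unfolding \<psi>_def
      by (intro DERIV_add DERIV_diff DERIV_cmult DERIV_cmult_Id assms(4) \<tau>)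
    moreover have "\<phi>' \<tau> - A + 8 * K * (- (1/8) * (s - \<tau>) powr (-7/8)) \<le> 0"
      using assms(5)[OF \<tau>] by simp
    ultimately show "\<exists>y. (\<psi> has_real_derivative y) (at \<tau>) \<and> y \<le> 0" by blast
  qed
  then show ?thesis by (simp add: \<psi>_def algebra_simps)
qed

section \<open>Fourier coefficients and the observation operator\<close>

lemma integral_lborel_prod:
  fixes f :: "'a::euclidean_space \<Rightarrow> real \<Rightarrow> complex"
  assumes "\<And>b. b \<in> Basis \<Longrightarrow> integrable lborel (f b)"
  shows "(LINT x|lborel. (\<Prod>b\<in>Basis. f b (x \<bullet> b))) = (\<Prod>b\<in>Basis. LINT x|lborel. f b x)"
proof -
  interpret product_sigma_finite "\<lambda>_ :: 'a. lborel :: real measure" ..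
  have [measurable]: "f b \<in> borel_measurable borel" if "b \<in> Basis" for b
    using assms[OF that] by (auto dest: borel_measurable_integrable)
  have "(LINT x|lborel. (\<Prod>b\<in>Basis. f b (x \<bullet> b))) =
    (LINT x|(\<Pi>\<^sub>M b\<in>Basis. lborel). (\<Prod>b\<in>Basis. f b ((\<Sum>c\<in>Basis. x c *\<^sub>R c) \<bullet> b)))"
    by (subst lborel_eq) (simp add: integral_distr)
  also have "\<dots> = (LINT x|(\<Pi>\<^sub>M b\<in>Basis. lborel). (\<Prod>b\<in>Basis. f b (x b)))"
    by (intro Bochner_Integration.integral_cong prod.cong) auto
  also have "\<dots> = (\<Prod>b\<in>Basis. LINT x|lborel. f b x)"
    by (rule product_integral_prod) (use assms in auto)
  finally show ?thesis .
qed

lemma integral_cis_period: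
  fixes n :: int
  assumes "L > 0" "n \<noteq> 0"
  shows "(LINT x|lborel. indicator {0..L} x *\<^sub>R cis (2 * pi * of_int n / L * x)) = 0"
proof -
  define a where "a = 2 * pi * of_int n / L"
  have a: "a \<noteq> 0" using assms by (simp add: a_def)
  define G where "G x = exp (\<i> * complex_of_real a * complex_of_real x) / (\<i> * complex_of_real a)" for x
  have cis: "cis (a * x) = exp (\<i> * complex_of_real a * complex_of_real x)" for x
    by (simp add: cis_conv_exp mult.assoc)
  have "(G has_vector_derivative cis (a * x)) (at x within {0..L})" for x
    unfolding G_def cis
    using a by (intro has_vector_derivative_real_field) (auto intro!: derivative_eq_intros)
  moreover have "continuous_on {0..L} (\<lambda>x. cis (a * x))"
    by (intro continuous_intros)
  ultimately have "(LINT x|lborel. indicator {0..L} x *\<^sub>R cis (a * x)) = G L - G 0"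
    using assms by (intro integral_FTC_atLeastAtMost) auto
  also have "a * L = 2 * pi * of_int n"
    using assms by (simp add: a_def)
  then have "G L = G 0"
    using cis[of L] cis[of 0] by (simp add: G_def)
  finally show ?thesis by (simp add: a_def)
qed

lemma borel_measurable_cis_inner [measurable]: "(\<lambda>x :: real^2. cis (k \<bullet> x)) \<in> borel_measurable borel"
  by (intro borel_measurable_continuous_onI continuous_intros)

lemma borel_measurable_lebesgue_cis_inner [measurable]:
  "(\<lambda>x :: real^2. cis (k \<bullet> x)) \<in> borel_measurable (lebesgue_on X)"
  by (intro measurable_restrict_space1) (simp add: measurable_completion)

lemma cis_mult_cnj_inner: "cis (k \<bullet> x) * cnj (cis (m \<bullet> x)) = cis ((k - m) \<bullet> x)"
  by (simp add: cis_cnj cis_mult inner_diff_left)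

lemma cis_inner: "cis (k \<bullet> x) = (\<Prod>b\<in>Basis. cis ((k \<bullet> b) * (x \<bullet> b)))"
  by (subst euclidean_inner) (simp add: cis_conv_exp exp_sum sum_distrib_left)

text \<open>The exponential factorises over the coordinates, and a coordinate with nonzero n_i
  contributes the integral of an oscillation over whole periods.\<close>

lemma integral_cis_Omega:
  fixes n :: "int^2"
  assumes "L > 0" "n \<noteq> 0"
  shows "(LINT x|lebesgue_on (Omega L). cis (((2 * pi / L) *\<^sub>R (\<chi> i. of_int (n $ i))) \<bullet> x)) = 0"
proof -
  let ?k = "(2 * pi / L) *\<^sub>R (\<chi> i. of_int (n $ i)) :: real^2"
  let ?f = "\<lambda>b y. indicator {0..L} y *\<^sub>R cis ((?k \<bullet> b) * y)"
  have ind: "indicator (Omega L) x = (\<Prod>b\<in>Basis. indicator {0..L} (x \<bullet> b) :: real)" for x :: "real^2"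
  proof -
    have "x \<in> Omega L \<longleftrightarrow> (\<forall>b\<in>Basis. x \<bullet> b \<in> {0..L})"
      by (auto simp: Omega_def mem_box Basis_vec_def inner_axis)
    then show ?thesis
      by (auto simp: indicator_def prod_zero_iff)
  qed
  have "(LINT x|lebesgue_on (Omega L). cis (?k \<bullet> x))
      = (LINT x|lebesgue. indicator (Omega L) x *\<^sub>R cis (?k \<bullet> x))"
    by (subst integral_restrict_space) (auto simp: Omega_def)
  also have "\<dots> = (LINT x|lborel. indicator (Omega L) x *\<^sub>R cis (?k \<bullet> x))"
    using borel_measurable_cis_inner[of ?k]
    by (intro integral_completion borel_measurable_scaleR borel_measurable_indicator)
       (auto simp: Omega_def)
  also have "\<dots> = (LINT x|lborel. (\<Prod>b\<in>Basis. ?f b (x \<bullet> b)))"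
    by (intro Bochner_Integration.integral_cong refl)
       (simp add: ind cis_inner scaleR_conv_of_real prod.distrib)
  also have "\<dots> = (\<Prod>b\<in>Basis. LINT y|lborel. ?f b y)"
  proof (rule integral_lborel_prod)
    fix b :: "real^2"
    have "set_integrable lborel {0..L} (\<lambda>y. cis ((?k \<bullet> b) * y))"
      by (intro borel_integrable_atLeastAtMost' continuous_intros)
    then show "integrable lborel (?f b)" by (simp add: set_integrable_def)
  qed
  also have "\<dots> = 0"
  proof -
    obtain i where i: "n $ i \<noteq> 0" using assms(2) by (auto simp: vec_eq_iff)
    have b: "axis i 1 \<in> (Basis :: (real^2) set)" by (simp add: axis_in_Basis_iff)
    moreover have "(LINT y|lborel. ?f (axis i 1) y) = 0"
      using integral_cis_period[OF assms(1) i] by (simp add: inner_axis)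
    ultimately show ?thesis using prod_zero[OF finite_Basis, of "\<lambda>b. LINT y|lborel. ?f b y"]
      by blast
  qed
  finally show ?thesis .
qed

lemma finite_measure_Omega: "finite_measure (lebesgue_on (Omega L))"
  by (auto simp: Omega_def intro!: finite_measure_lebesgue_on)

lemma measure_Omega: "L > 0 \<Longrightarrow> measure (lebesgue_on (Omega L)) (Omega L) = L\<^sup>2"
  by (simp add: Omega_def measure_restrict_space content_cbox_cart interval_ne_empty_cart)

lemma integral_cis_orthogonal:
  assumes "L > 0" "k \<in> wavevectors L" "m \<in> wavevectors L"
  shows "(LINT x|lebesgue_on (Omega L). cis (k \<bullet> x) * cnj (cis (m \<bullet> x)))
    = (if k = m then complex_of_real (L\<^sup>2) else 0)"
proof (cases "k = m")
  case True
  then show ?thesis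
    using assms(1) by (simp add: cis_mult_cnj_inner measure_Omega scaleR_conv_of_real)
next
  case False
  obtain n n' :: "int^2" where n: "k = (2 * pi / L) *\<^sub>R (\<chi> i. of_int (n $ i))"
    "m = (2 * pi / L) *\<^sub>R (\<chi> i. of_int (n' $ i))"
    using assms by (metis wavevectors_cases)
  then have nn: "n - n' \<noteq> 0" and km: "k - m = (2 * pi / L) *\<^sub>R (\<chi> i. of_int ((n - n') $ i))"
    using False by (auto simp: vec_eq_iff algebra_simps diff_divide_distrib)
  then show ?thesis
    unfolding cis_mult_cnj_inner km using False integral_cis_Omega[OF assms(1) nn]
    by (simp only: if_False)
qed

lemma L2_component_integrable:
  assumes "w \<in> L2 L"
  shows "integrable (lebesgue_on (Omega L)) (\<lambda>x. (w x $ j)\<^sup>2)"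
    and "integrable (lebesgue_on (Omega L)) (\<lambda>x. complex_of_real (w x $ j) * cis (k \<bullet> x))"
proof -
  let ?M = "lebesgue_on (Omega L)"
  interpret finite_measure ?M by (rule finite_measure_Omega)
  have w: "w \<in> borel_measurable ?M" "integrable ?M (\<lambda>x. (norm (w x))\<^sup>2)"
    using assms by (auto simp: L2_def)
  have wj [measurable]: "(\<lambda>x. w x $ j) \<in> borel_measurable ?M"
    using borel_measurable_inner[OF w(1) borel_measurable_const[of "axis j 1"]]
    by (simp add: inner_axis)
  have le: "(w x $ j)\<^sup>2 \<le> (norm (w x))\<^sup>2" for x
    using component_le_norm_cart[of "w x" j] by (simp add: abs_le_square_iff[symmetric])
  show "integrable ?M (\<lambda>x. (w x $ j)\<^sup>2)"
    by (rule Bochner_Integration.integrable_bound[OF w(2)]) (use le in auto)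
  have "integrable ?M (\<lambda>x. 1 + (norm (w x))\<^sup>2)"
    using w(2) by auto
  then show "integrable ?M (\<lambda>x. complex_of_real (w x $ j) * cis (k \<bullet> x))"
  proof (rule Bochner_Integration.integrable_bound)
    have "\<bar>w x $ j\<bar> \<le> 1 + (norm (w x))\<^sup>2" for x
      using le[of x] sum_squares_bound[of "\<bar>w x $ j\<bar>" 1] zero_le_power2[of "w x $ j"] by simp
    then show "AE x in ?M. norm (complex_of_real (w x $ j) * cis (k \<bullet> x)) \<le> norm (1 + (norm (w x))\<^sup>2)"
      by (auto simp: norm_mult)
  qed measurable
qed

lemma integral_cis_fourier_coeff:
  assumes "L > 0"
  shows "(LINT x|lebesgue_on (Omega L). complex_of_real (w x $ j) * cis (- (k \<bullet> x)))
    = complex_of_real (L\<^sup>2) * fourier_coeff L w k $ j"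
  using assms by (simp add: fourier_coeff_def)

text \<open>Expand the integral of |w_j - P|^2 >= 0, where P is the trigonometric polynomial of w_j
  on F. The cross term integrates to s by the definition of the coefficients, and |P|^2 does by
  orthogonality.\<close>

lemma bessel_inequality_component:
  assumes "L > 0" "w \<in> L2 L" "finite F" "F \<subseteq> wavevectors L"
  shows "L\<^sup>2 * (\<Sum>k\<in>F. (cmod (fourier_coeff L w k $ j))\<^sup>2)
    \<le> (LINT x|lebesgue_on (Omega L). (w x $ j)\<^sup>2)"
proof -
  let ?M = "lebesgue_on (Omega L)"
  interpret finite_measure ?M by (rule finite_measure_Omega)
  define c where "c k = fourier_coeff L w k $ j" for k
  define P where "P x = (\<Sum>k\<in>F. c k * cis (k \<bullet> x))" for x
  define s where "s = L\<^sup>2 * (\<Sum>k\<in>F. (cmod (c k))\<^sup>2)"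
  have s: "complex_of_real s = (\<Sum>k\<in>F. cnj (c k) * (complex_of_real (L\<^sup>2) * c k))"
    unfolding s_def of_real_mult of_real_sum complex_norm_square sum_distrib_left
    by (simp add: mult_ac)
  have int_e: "integrable ?M (\<lambda>x. cis (k \<bullet> x) * cnj (cis (m \<bullet> x)))" for k m
    unfolding cis_mult_cnj_inner by (rule integrable_const_bound[where B = 1]) auto
  have int_w: "integrable ?M (\<lambda>x. complex_of_real (w x $ j) * cnj (cis (k \<bullet> x)))" for k
    using L2_component_integrable(2)[OF assms(2), of j "- k"] by (simp add: cis_cnj)
  have wP: "complex_of_real (w x $ j) * cnj (P x)
      = (\<Sum>k\<in>F. cnj (c k) * (complex_of_real (w x $ j) * cnj (cis (k \<bullet> x))))" for x
    by (simp add: P_def sum_distrib_left mult_ac)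
  have PP: "P x * cnj (P x) = (\<Sum>k\<in>F. \<Sum>m\<in>F. c k * cnj (c m) * (cis (k \<bullet> x) * cnj (cis (m \<bullet> x))))" for x
    by (simp add: P_def sum_product mult_ac)
  have int1: "integrable ?M (\<lambda>x. complex_of_real (w x $ j) * cnj (P x))"
    unfolding wP by (intro Bochner_Integration.integrable_sum integrable_mult_right int_w)
  have int2: "integrable ?M (\<lambda>x. P x * cnj (P x))"
    unfolding PP by (intro Bochner_Integration.integrable_sum integrable_mult_right int_e)
  have "(LINT x|?M. complex_of_real (w x $ j) * cnj (P x))
      = (\<Sum>k\<in>F. cnj (c k) * (complex_of_real (L\<^sup>2) * c k))"
    unfolding wP
    using integral_cis_fourier_coeff[OF assms(1), of w j]
    by (subst Bochner_Integration.integral_sum)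
       (auto simp: cis_cnj c_def intro!: integrable_mult_right int_w[unfolded cis_cnj])
  also have "\<dots> = complex_of_real s" by (rule s[symmetric])
  finally have I1: "(LINT x|?M. complex_of_real (w x $ j) * cnj (P x)) = complex_of_real s" .
  have "(LINT x|?M. P x * cnj (P x))
      = (\<Sum>k\<in>F. \<Sum>m\<in>F. c k * cnj (c m) * (if k = m then complex_of_real (L\<^sup>2) else 0))"
    unfolding PP
    using assms(1,4) int_e
    by (simp add: Bochner_Integration.integral_sum integral_cis_orthogonal subset_iff)
  also have "\<dots> = complex_of_real s"
    using assms(3) by (simp add: s if_distrib mult_ac cong: if_cong)
  finally have I2: "(LINT x|?M. P x * cnj (P x)) = complex_of_real s" .
  have "0 \<le> (LINT x|?M. (w x $ j)\<^sup>2 - 2 * Re (complex_of_real (w x $ j) * cnj (P x)) + Re (P x * cnj (P x)))"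
  proof (rule Bochner_Integration.integral_nonneg)
    fix x
    have "(w x $ j)\<^sup>2 - 2 * Re (complex_of_real (w x $ j) * cnj (P x)) + Re (P x * cnj (P x))
        = (w x $ j - Re (P x))\<^sup>2 + (Im (P x))\<^sup>2"
      by (simp add: power2_eq_square algebra_simps)
    then show "0 \<le> (w x $ j)\<^sup>2 - 2 * Re (complex_of_real (w x $ j) * cnj (P x)) + Re (P x * cnj (P x))"
      by simp
  qed
  also have "\<dots> = (LINT x|?M. (w x $ j)\<^sup>2) - 2 * Re (complex_of_real s) + Re (complex_of_real s)"
  proof -
    have i: "integrable ?M (\<lambda>x. (w x $ j)\<^sup>2)"
        "integrable ?M (\<lambda>x. 2 * Re (complex_of_real (w x $ j) * cnj (P x)))"
        "integrable ?M (\<lambda>x. Re (P x * cnj (P x)))"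
      using L2_component_integrable(1)[OF assms(2), of j] int1 int2
      by (safe intro!: integrable_mult_right integrable_Re)
    show ?thesis
      unfolding Bochner_Integration.integral_add[OF Bochner_Integration.integrable_diff[OF i(1,2)] i(3)]
        Bochner_Integration.integral_diff[OF i(1,2)] integral_mult_right_zero
        integral_Re[OF int1] integral_Re[OF int2] I1 I2 ..
  qed
  finally show ?thesis by (simp add: s_def c_def)
qed

text \<open>The approximation property of the interpolant is stated through an
  \<open>infsum\<close>, which is 0 on a divergent family. It bounds coefficients only once the
  remainder is known to be square summable.\<close>

lemma summable_on_fourier_coeff:
  assumes "L > 0" "w \<in> L2 L"
  shows "(\<lambda>k. (norm (fourier_coeff L w k))\<^sup>2) summable_on wavevectors L"
proof -
  let ?I = "\<lambda>j. (LINT x|lebesgue_on (Omega L). (w x $ j)\<^sup>2) / L\<^sup>2"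
  have "(\<Sum>k\<in>F. (norm (fourier_coeff L w k))\<^sup>2) \<le> ?I 1 + ?I 2"
    if F: "finite F" "F \<subseteq> wavevectors L" for F
  proof -
    have "(\<Sum>k\<in>F. (cmod (fourier_coeff L w k $ j))\<^sup>2) \<le> ?I j" for j
      using bessel_inequality_component[OF assms F, of j] assms(1) by (simp add: field_simps)
    from add_mono[OF this[of 1] this[of 2]] show ?thesis
      by (simp add: norm_vec_def L2_set_def sum_2 sum.distrib)
  qed
  then show ?thesis
    by (intro nonneg_bounded_partial_sums_imp_summable_on[where C = "?I 1 + ?I 2"])
       (auto simp: eventually_finite_subsets_at_top intro!: exI[of _ "{}"])
qed

text \<open>The interpolant is linear only up to null sets, which the Fourier integrals do not
  see.\<close>

lemma fourier_coeff_lincomb: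
  assumes "w \<in> L2 L" "w1 \<in> L2 L" "w2 \<in> L2 L"
    and "AE x in lebesgue_on (Omega L). w x = a *\<^sub>R w1 x + b *\<^sub>R w2 x"
  shows "fourier_coeff L w k = a *\<^sub>R fourier_coeff L w1 k + b *\<^sub>R fourier_coeff L w2 k"
proof -
  let ?M = "lebesgue_on (Omega L)"
  let ?g = "\<lambda>w j x. complex_of_real (w x $ j) * cis (- (k \<bullet> x))"
  have int: "integrable ?M (?g w j)" if "w \<in> L2 L" for w j
    using L2_component_integrable(2)[OF that, of j "- k"] by simp
  have "(LINT x|?M. ?g w j x) = a *\<^sub>R (LINT x|?M. ?g w1 j x) + b *\<^sub>R (LINT x|?M. ?g w2 j x)" for j
  proof -
    have "(LINT x|?M. ?g w j x) = (LINT x|?M. a *\<^sub>R ?g w1 j x + b *\<^sub>R ?g w2 j x)"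
      using assms(4)
      by (intro integral_cong_AE borel_measurable_integrable int assms Bochner_Integration.integrable_add
            integrable_scaleR_right)
         (auto simp: scaleR_conv_of_real[where 'a = complex] algebra_simps)
    then show ?thesis
      using int assms by simp
  qed
  then show ?thesis
    by (simp add: fourier_coeff_def vec_eq_iff algebra_simps)
qed

section \<open>The observation operator as a bounded map of finite range\<close>

lemma obs_support: "J = obs L lam Ih \<Longrightarrow> k \<notin> {k \<in> wavevectors L. (norm k)\<^sup>2 \<le> lam} \<Longrightarrow> J u k = 0"
  by (auto simp: obs_def Plam_def PH_def leray_def)

lemma leray_uminus:
  assumes "k \<in> wavevectors L" "a (- k) = cnjv (a k)"
  shows "leray L a (- k) = cnjv (leray L a k)"
proof -
  have "cvec (- k) = - cvec k" "cnjv (cvec k) = cvec k"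
    by (simp_all add: cvec_def cnjv_def vec_eq_iff)
  then show ?thesis
    using assms wavevectors_uminus[OF assms(1)]
    by (simp add: leray_def vec_eq_iff cnjv_def cdot_def cvec_def sum_2
        diff_divide_distrib add_divide_distrib algebra_simps)
qed

text \<open>Only finitely many modes survive, so summability is free for every \<alpha>, and
  conjugate symmetry holds for the coefficients of any real field. The inserted states therefore
  stay in V.\<close>

lemma obs_in_Vspace:
  assumes "L > 0"
  shows "obs L lam Ih u \<in> Vspace L \<alpha>"
proof -
  let ?J = "obs L lam Ih u"
  let ?c = "fourier_coeff L (Ih u)"
  have "leray L ?c (- k) = cnjv (leray L ?c k)" if "k \<in> wavevectors L" for k
    using that by (rule leray_uminus) (rule fourier_coeff_uminus)
  moreover have "(\<lambda>k. norm k powr (2 * \<alpha>) * (norm (?J k))\<^sup>2) summable_on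
      {k \<in> wavevectors L. (norm k)\<^sup>2 \<le> lam}"
    using finite_wavevectors_le[OF assms] by simp
  then have "(\<lambda>k. norm k powr (2 * \<alpha>) * (norm (?J k))\<^sup>2) summable_on wavevectors L"
    by (rule summable_on_cong_neutral[THEN iffD1, rotated -1]) (auto simp: obs_support[OF refl])
  moreover have "cdot (cvec k) 0 = 0" for k by (simp add: cdot_def)
  moreover have "cnjv 0 = 0" by (simp add: cnjv_def vec_eq_iff)
  ultimately show ?thesis
    using leray_divfree[OF assms]
    by (auto simp: Vspace_def obs_def Plam_def PH_def) (auto simp: leray_def)
qed

lemma obs_lincomb:
  assumes "interpolant L c1 h Ih" "u \<in> Vspace L 1" "v \<in> Vspace L 1"
  shows "obs L lam Ih (a \<cdot>\<^sub>S u + b \<cdot>\<^sub>S v) = a \<cdot>\<^sub>S obs L lam Ih u + b \<cdot>\<^sub>S obs L lam Ih v"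
proof -
  have "fourier_coeff L (Ih (a \<cdot>\<^sub>S u + b \<cdot>\<^sub>S v))
      = (\<lambda>k. a *\<^sub>R fourier_coeff L (Ih u) k + b *\<^sub>R fourier_coeff L (Ih v) k)"
    using assms Vspace_lincomb[OF assms(2,3)] unfolding interpolant_def
    by (intro ext fourier_coeff_lincomb) auto
  then show ?thesis
    unfolding obs_def PH_def by (simp only:) (simp add: Plam_def leray_lincomb fun_eq_iff)
qed

text \<open>P_H I u is u minus the interpolation error: the spectral gap controls the coefficients
  of u, the approximation property those of the error. Only boundedness is at stake, so the constant
  may grow with h.\<close>

lemma obs_bound:
  assumes "L > 0" "interpolant L c1 h Ih"
  obtains C where "C \<ge> 0"
    and "\<And>u k. u \<in> Vspace L 1 \<Longrightarrow> norm (obs L lam Ih u k) \<le> C * Vnorm L 1 u"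
proof
  \<comment> \<open>The first term is the inverse spectral gap L/(2 pi) divided by the factor L in
    the norm, the second the interpolation constant divided by L.\<close>
  define C where "C = 1 / (2 * pi) + sqrt \<bar>c1 * h\<^sup>2\<bar> / L"
  show "C \<ge> 0" using assms(1) by (simp add: C_def)
  fix u k assume u: "u \<in> Vspace L 1"
  let ?p = "PH L (Ih u)"
  show "norm (obs L lam Ih u k) \<le> C * Vnorm L 1 u"
  proof (cases "k \<in> wavevectors L")
    case True
    have "norm k > 0" using True wavevectors_nonzero[OF assms(1)] by auto
    have "2 * pi / L * (L * norm (u k)) \<le> norm k * (L * norm (u k))"
      using norm_wavevector_ge[OF assms(1) True] assms(1) by (intro mult_right_mono) auto
    also have "\<dots> = L * norm k powr 1 * norm (u k)"
      using \<open>norm k > 0\<close> by simp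
    also have "\<dots> \<le> Vnorm L 1 u"
      using u by (intro norm_coeff_le_Vnorm assms(1)) (auto simp: Vspace_def)
    finally have 1: "norm (u k) \<le> 1 / (2 * pi) * Vnorm L 1 u"
      using assms(1) by (simp add: field_simps)
    have "Ih u \<in> L2 L"
      using assms(2) u by (auto simp: interpolant_def)
    from summable_on_fourier_coeff[OF assms(1) this]
    have "(\<lambda>k. (norm (?p k))\<^sup>2) summable_on wavevectors L"
      by (rule summable_on_comparison_test)
         (auto simp: PH_def intro!: power_mono norm_leray_le assms(1))
    moreover have "(\<lambda>k. (norm k * norm (u k))\<^sup>2) summable_on wavevectors L"
      by (rule summable_on_subset[OF has_sum_imp_summable[OF has_sum_Vnorm1[OF assms(1) u]]]) simp
    ultimately have "(\<lambda>k. 2 * ((L / (2 * pi))\<^sup>2 * (norm k * norm (u k))\<^sup>2) + 2 * (norm (?p k))\<^sup>2)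
        summable_on wavevectors L"
      by (intro summable_on_add summable_on_cmult_right)
    then have "(\<lambda>k. (norm ((u - ?p) k))\<^sup>2) summable_on wavevectors L"
    proof (rule summable_on_comparison_test)
      fix k assume k: "k \<in> wavevectors L"
      have "1 \<le> L / (2 * pi) * norm k"
        using norm_wavevector_ge[OF assms(1) k] assms(1) by (simp add: field_simps)
      then have "1 * norm (u k) \<le> L / (2 * pi) * norm k * norm (u k)"
        by (rule mult_right_mono) auto
      then have "(norm (u k))\<^sup>2 \<le> (L / (2 * pi) * norm k * norm (u k))\<^sup>2"
        by (intro power_mono) auto
      also have "\<dots> = (L / (2 * pi))\<^sup>2 * (norm k * norm (u k))\<^sup>2"
        by (simp only: power_mult_distrib mult.assoc)
      finally have le: "(norm (u k))\<^sup>2 \<le> (L / (2 * pi))\<^sup>2 * (norm k * norm (u k))\<^sup>2" .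
      have "(norm ((u - ?p) k))\<^sup>2 \<le> (norm (u k) + norm (?p k))\<^sup>2"
        using norm_triangle_ineq4[of "u k" "?p k"] by (intro power_mono) auto
      also have "\<dots> \<le> 2 * (norm (u k))\<^sup>2 + 2 * (norm (?p k))\<^sup>2"
        using sum_squares_bound[of "norm (u k)" "norm (?p k)"] by (simp add: power2_sum)
      finally show "(norm ((u - ?p) k))\<^sup>2
          \<le> 2 * ((L / (2 * pi))\<^sup>2 * (norm k * norm (u k))\<^sup>2) + 2 * (norm (?p k))\<^sup>2"
        using le by linarith
    qed auto
    then have "(\<lambda>k. norm k powr (2 * 0) * (norm ((u - ?p) k))\<^sup>2) summable_on wavevectors L"
      by (rule summable_on_cong[THEN iffD1, rotated])
         (use wavevectors_nonzero[OF assms(1)] in auto)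
    then have "L * norm k powr 0 * norm ((u - ?p) k) \<le> Vnorm L 0 (u - ?p)"
      using u by (intro norm_coeff_le_Vnorm assms(1)) (auto simp: Vspace_def PH_def leray_def)
    also have "\<dots> \<le> sqrt (c1 * h\<^sup>2 * (Vnorm L 1 u)\<^sup>2)"
      using assms(2) u by (intro real_le_rsqrt) (auto simp: interpolant_def)
    also have "\<dots> \<le> sqrt (\<bar>c1 * h\<^sup>2\<bar> * (Vnorm L 1 u)\<^sup>2)"
      by (intro real_sqrt_le_mono mult_right_mono) auto
    also have "\<dots> = sqrt \<bar>c1 * h\<^sup>2\<bar> * Vnorm L 1 u"
      using Vnorm_nonneg by (simp add: real_sqrt_mult)
    finally have 2: "norm ((u - ?p) k) \<le> sqrt \<bar>c1 * h\<^sup>2\<bar> / L * Vnorm L 1 u"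
      using assms(1) \<open>norm k > 0\<close> by (simp add: field_simps)
    have "norm (obs L lam Ih u k) \<le> norm (?p k)"
      by (simp add: obs_def Plam_def)
    also have "\<dots> \<le> norm (u k) + norm ((u - ?p) k)"
      using norm_triangle_ineq4[of "u k" "(u - ?p) k"] by simp
    also have "\<dots> \<le> C * Vnorm L 1 u"
      using 1 2 by (simp add: C_def distrib_right)
    finally show ?thesis .
  next
    case False
    then show ?thesis
      using \<open>C \<ge> 0\<close> Vnorm_nonneg by (simp add: obs_support[OF refl])
  qed
qed

section \<open>Comparison of direct insertion with nudging\<close>

lemma abs_exp_minus_diff_le:
  fixes x y :: real
  assumes "0 \<le> x" "0 \<le> y"
  shows "\<bar>exp (- x) - exp (- y)\<bar> \<le> \<bar>x - y\<bar>"
proof -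
  have *: "exp (- a) - exp (- b) \<le> b - a" if "0 \<le> a" "a \<le> b" for a b :: real
  proof -
    have "exp (- a) - exp (- b) = exp (- a) * (1 - exp (- (b - a)))"
      by (simp add: algebra_simps exp_add[symmetric])
    also have "\<dots> \<le> 1 * (1 - exp (- (b - a)))"
      using that by (intro mult_right_mono) auto
    also have "\<dots> \<le> b - a"
      using exp_ge_add_one_self[of "- (b - a)"] by (simp del: exp_ge_add_one_self)
    finally show ?thesis .
  qed
  show ?thesis
    using *[of x y] *[of y x] assms by (cases "x \<le> y") auto
qed

text \<open>A right-endpoint rectangle under the weight is compared with the increment of the
  weight; the factor e is the loss from evaluating at the right endpoint. Over successive
  observation times the increments telescope and leave the gain 1/\<beta>.\<close>

lemma mult_le_exp_diff:
  fixes d \<beta> x :: real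
  assumes "0 < \<beta>" "0 \<le> d" "\<beta> * d \<le> 1"
  shows "d * exp (x + \<beta> * d) \<le> exp 1 / \<beta> * (exp (x + \<beta> * d) - exp x)"
proof -
  have "\<beta> * d * exp x \<le> (exp (\<beta> * d) - 1) * exp x"
    using exp_ge_add_one_self[of "\<beta> * d"] by (intro mult_right_mono) (linarith | simp)+
  then have le: "\<beta> * d * exp x \<le> exp (x + \<beta> * d) - exp x"
    by (simp add: exp_add algebra_simps)
  have "d * exp (x + \<beta> * d) = d * exp x * exp (\<beta> * d)"
    by (simp add: exp_add)
  also have "\<dots> \<le> d * exp x * exp 1"
    using assms by (intro mult_left_mono) auto
  also have "\<dots> = exp 1 / \<beta> * (\<beta> * d * exp x)"
    using assms by simp
  also have "\<dots> \<le> exp 1 / \<beta> * (exp (x + \<beta> * d) - exp x)"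
    using assms by (intro mult_left_mono le) auto
  finally show ?thesis .
qed

text \<open>Of \<open>J\<close> only linearity and boundedness on V and a fixed finite set of modes
  are retained. No relation between h, \<lambda> and \<mu> that would force synchronisation enters.
  For finite range the coefficient bound \<open>cJ\<close> is as good as a bound in norm.\<close>

locale nudging =
  fixes L \<nu> \<mu> t0 T cJ :: real and f :: series
    and S :: "real \<Rightarrow> series \<Rightarrow> series" and J :: "series \<Rightarrow> series"
    and U v :: "real \<Rightarrow> series" and K :: "(real^2) set"
  assumes L: "L > 0" and \<nu>: "\<nu> > 0" and \<mu>: "\<mu> > 0" and T: "t0 < T"
    and S: "solution_semigroup L \<nu> f S"
    and U: "ns_solution L \<nu> (\<lambda>_. f) t0 U"
    and v: "ns_solution L \<nu> (\<lambda>t. f + \<mu> \<cdot>\<^sub>S J (U t - v t)) t0 v"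
    and v0: "v t0 = J (U t0)"
    and J_in_Vspace: "J u \<in> Vspace L 1"
    and J_diff: "u \<in> Vspace L 1 \<Longrightarrow> u' \<in> Vspace L 1 \<Longrightarrow> J (u - u') = J u - J u'"
    and K: "finite K"
    and J_support: "k \<notin> K \<Longrightarrow> J u k = 0"
    and J_bound: "u \<in> Vspace L 1 \<Longrightarrow> norm (J u k) \<le> cJ * Vnorm L 1 u"
    and cJ: "0 \<le> cJ"
begin

definition y :: "real \<Rightarrow> series" where
  "y t = \<mu> \<cdot>\<^sub>S J (U t - v t)"

definition tm :: "real \<Rightarrow> nat \<Rightarrow> real" where
  "tm \<delta> n = t0 + \<delta> * real n"

definition un :: "real \<Rightarrow> nat \<Rightarrow> series" where
  "un \<delta> n = insertion_seq S J U t0 \<delta> (\<mu> * \<delta>) n"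

text \<open>
  The error on the closed interval \<open>[t\<^sub>n, t\<^bsub>n+1\<^esub>]\<close>: at the right endpoint \<open>w \<delta> n\<close> is the error
  before the insertion and \<open>w \<delta> (n + 1)\<close> the one after it.
\<close>

definition w :: "real \<Rightarrow> nat \<Rightarrow> real \<Rightarrow> series" where
  "w \<delta> n \<tau> = S (\<tau> - tm \<delta> n) (un \<delta> n) - v \<tau>"

lemma tm_0 [simp]: "tm \<delta> 0 = t0"
  and tm_Suc: "tm \<delta> (Suc n) = tm \<delta> n + \<delta>"
  by (simp_all add: tm_def algebra_simps)

lemma tm_mono: "0 \<le> \<delta> \<Longrightarrow> j \<le> n \<Longrightarrow> tm \<delta> j \<le> tm \<delta> n"
  by (simp add: tm_def mult_left_mono)

lemma tm_ge: "0 \<le> \<delta> \<Longrightarrow> t0 \<le> tm \<delta> n"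
  by (simp add: tm_def)

lemma U_in: "t0 \<le> t \<Longrightarrow> U t \<in> Vspace L 1"
  and v_in: "t0 \<le> t \<Longrightarrow> v t \<in> Vspace L 1"
  using U v by (auto intro: ns_solution_in_Vspace)

lemma S_solution: "u \<in> Vspace L 1 \<Longrightarrow> ns_solution L \<nu> (\<lambda>_. f) 0 (\<lambda>t. S t u)"
  and S_0: "u \<in> Vspace L 1 \<Longrightarrow> S 0 u = u"
  using S by (auto simp: solution_semigroup_def)

lemma S_in: "u \<in> Vspace L 1 \<Longrightarrow> 0 \<le> t \<Longrightarrow> S t u \<in> Vspace L 1"
  using ns_solution_in_Vspace[OF S_solution] by blast

lemma un_in:
  assumes "0 \<le> \<delta>"
  shows "un \<delta> n \<in> Vspace L 1"
proof (induction n)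
  case (Suc n)
  then show ?case
    unfolding un_def insertion_seq.simps
    by (intro Vspace_add Vspace_smul S_in J_in_Vspace assms)
qed (simp add: un_def J_in_Vspace)

lemma w_in: "0 \<le> \<delta> \<Longrightarrow> tm \<delta> n \<le> \<tau> \<Longrightarrow> w \<delta> n \<tau> \<in> Vspace L 1"
  using tm_ge[of \<delta> n] by (auto simp: w_def intro!: Vspace_diff S_in un_in v_in)

lemma w_0: "0 \<le> \<delta> \<Longrightarrow> w \<delta> 0 t0 = 0"
  using S_0[OF un_in[of \<delta> 0]] by (simp add: w_def un_def v0 fun_eq_iff)

text \<open>The innovation is (U - v) - w. The first part yields \<delta> y, one rectangle in the
  quadrature of the nudging force; the second is a feedback on the error, a factor \<delta> smaller
  than the error itself.\<close>

lemma w_Suc: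
  assumes "0 \<le> \<delta>"
  shows "w \<delta> (Suc n) (tm \<delta> (Suc n)) = w \<delta> n (tm \<delta> (Suc n))
    + (\<delta> \<cdot>\<^sub>S y (tm \<delta> (Suc n)) - (\<mu> * \<delta>) \<cdot>\<^sub>S J (w \<delta> n (tm \<delta> (Suc n))))"
proof -
  define t where "t = tm \<delta> (Suc n)"
  have t: "t0 \<le> t" "tm \<delta> n \<le> t" "t - tm \<delta> n = \<delta>" "t0 + \<delta> * real (Suc n) = t"
    using assms tm_ge[of \<delta> "Suc n"] by (auto simp: t_def tm_def algebra_simps)
  have "U t - S \<delta> (un \<delta> n) = (U t - v t) - w \<delta> n t"
    by (simp add: w_def t(3))
  then have "J (U t - S \<delta> (un \<delta> n)) = J ((U t - v t) - w \<delta> n t)"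
    by (simp only:)
  also have "\<dots> = J (U t - v t) - J (w \<delta> n t)"
    using t assms by (intro J_diff Vspace_diff U_in v_in w_in)
  finally have "J (U t - S \<delta> (un \<delta> n)) = J (U t - v t) - J (w \<delta> n t)" .
  then have "un \<delta> (Suc n) = S \<delta> (un \<delta> n) + (\<mu> * \<delta>) \<cdot>\<^sub>S (J (U t - v t) - J (w \<delta> n t))"
    unfolding un_def insertion_seq.simps t(4) by simp
  then have e1: "un \<delta> (Suc n) k = S \<delta> (un \<delta> n) k + (\<mu> * \<delta>) *\<^sub>R (J (U t - v t) k - J (w \<delta> n t) k)" for k
    by simp
  have e2: "w \<delta> (Suc n) t k = un \<delta> (Suc n) k - v t k" for k
    using S_0[OF un_in[OF assms]] by (simp add: w_def t_def)
  have e3: "S \<delta> (un \<delta> n) k = w \<delta> n t k + v t k" for k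
    by (simp add: w_def t(3))
  show ?thesis
    unfolding t_def[symmetric]
  proof
    fix k
    show "w \<delta> (Suc n) t k = (w \<delta> n t + (\<delta> \<cdot>\<^sub>S y t - (\<mu> * \<delta>) \<cdot>\<^sub>S J (w \<delta> n t))) k"
      unfolding e2 e1 e3 by (simp add: y_def algebra_simps)
  qed
qed

lemma y_support: "k \<notin> K \<Longrightarrow> y t k = 0"
  by (simp add: y_def J_support)

lemma y_continuous: "continuous_on {t0..} (\<lambda>t. y t k)"
  unfolding continuous_on_def
proof
  fix t assume t: "t \<in> {t0..}"
  have lim: "((\<lambda>s. \<mu> * (cJ * (Vnorm L 1 (U s - U t) + Vnorm L 1 (v s - v t)))) \<longlongrightarrow> 0) (at t within {t0..})"
    using t by (auto intro!: tendsto_eq_intros ns_solution_Vtendsto[OF U] ns_solution_Vtendsto[OF v])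
  have "((\<lambda>s. y s k - y t k) \<longlongrightarrow> 0) (at t within {t0..})"
  proof (rule Lim_null_comparison[OF _ lim])
    have "norm (y s k - y t k) \<le> \<mu> * (cJ * (Vnorm L 1 (U s - U t) + Vnorm L 1 (v s - v t)))"
      if "s \<in> {t0..}" for s
    proof -
      have V: "U s \<in> Vspace L 1" "U t \<in> Vspace L 1" "v s \<in> Vspace L 1" "v t \<in> Vspace L 1"
        using t that by (auto intro: U_in v_in)
      have "(U s - v s) - (U t - v t) = (U s - U t) - (v s - v t)" by simp
      then have "J (U s - v s) - J (U t - v t) = J ((U s - U t) - (v s - v t))"
        using V by (metis J_diff Vspace_diff)
      then have "y s k - y t k = \<mu> *\<^sub>R J ((U s - U t) - (v s - v t)) k"
        by (simp add: y_def scaleR_diff_right[symmetric] fun_diff_def fun_eq_iff)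
      then have "norm (y s k - y t k) = \<mu> * norm (J ((U s - U t) - (v s - v t)) k)"
        using \<mu> by simp
      also have "norm (J ((U s - U t) - (v s - v t)) k) \<le> cJ * Vnorm L 1 ((U s - U t) - (v s - v t))"
        using V by (intro J_bound Vspace_diff)
      also have "Vnorm L 1 ((U s - U t) - (v s - v t)) \<le> Vnorm L 1 (U s - U t) + Vnorm L 1 (v s - v t)"
        using V by (intro Vnorm1_diff_le L Vspace_diff)
      finally show ?thesis
        using \<mu> cJ by (simp add: mult_left_mono)
    qed
    then show "\<forall>\<^sub>F s in at t within {t0..}.
        norm (y s k - y t k) \<le> \<mu> * (cJ * (Vnorm L 1 (U s - U t) + Vnorm L 1 (v s - v t)))"
      by (auto simp: eventually_at intro!: exI[of _ 1])
  qed
  then show "((\<lambda>s. y s k) \<longlongrightarrow> y t k) (at t within {t0..})"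
    by (rule LIM_zero_cancel)
qed

lemma y_bounded:
  obtains Y where "Y \<ge> 0" "\<And>\<tau> F. t0 \<le> \<tau> \<Longrightarrow> \<tau> \<le> T \<Longrightarrow> norm1 F (y \<tau>) \<le> Y"
proof -
  have "continuous_on {t0..T} (\<lambda>t. y t k)" for k
    using y_continuous by (rule continuous_on_subset) auto
  then have "compact ((\<lambda>t. \<Sum>k\<in>K. norm k * norm (y t k)) ` {t0..T})"
    by (intro compact_continuous_image continuous_intros) auto
  then have "bounded ((\<lambda>t. \<Sum>k\<in>K. norm k * norm (y t k)) ` {t0..T})"
    by (rule compact_imp_bounded)
  then obtain Y where Y: "\<forall>t\<in>{t0..T}. \<bar>\<Sum>k\<in>K. norm k * norm (y t k)\<bar> \<le> Y"
    unfolding bounded_iff by auto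
  show thesis
  proof
    show "Y \<ge> 0" using bspec[OF Y, of t0] T by auto
    show "norm1 F (y \<tau>) \<le> Y" if "t0 \<le> \<tau>" "\<tau> \<le> T" for \<tau> F
    proof -
      have "norm1 F (y \<tau>) \<le> (\<Sum>k\<in>K. norm k * norm (y \<tau> k))"
        by (rule norm1_le_sum[OF K y_support])
      then show ?thesis using bspec[OF Y, of \<tau>] that by auto
    qed
  qed
qed

lemma v_bounded:
  obtains M where "M \<ge> 0" "\<And>\<tau>. t0 \<le> \<tau> \<Longrightarrow> \<tau> \<le> T \<Longrightarrow> Vnorm L 1 (v \<tau>) \<le> M"
proof -
  have "continuous_on {t0..T} (\<lambda>t. Vnorm L 1 (v t))"
    using ns_solution_Vnorm1_continuous[OF L v] by (rule continuous_on_subset) auto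
  then have "compact ((\<lambda>t. Vnorm L 1 (v t)) ` {t0..T})"
    by (rule compact_continuous_image) auto
  then have "bounded ((\<lambda>t. Vnorm L 1 (v t)) ` {t0..T})"
    by (rule compact_imp_bounded)
  then obtain M where M: "\<forall>t\<in>{t0..T}. \<bar>Vnorm L 1 (v t)\<bar> \<le> M"
    unfolding bounded_iff by auto
  show thesis
  proof
    show "M \<ge> 0" using bspec[OF M, of t0] T by auto
    show "Vnorm L 1 (v \<tau>) \<le> M" if "t0 \<le> \<tau>" "\<tau> \<le> T" for \<tau>
      using bspec[OF M, of \<tau>] that by auto
  qed
qed

text \<open>On finitely many modes the heat multiplier is Lipschitz in time with constant \<nu>
  |k|^2, and the difference of the exponents involves only b - a. Hence \<open>d\<close> depends
  neither on s nor on F.\<close>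

lemma heat_y_modulus:
  assumes "\<omega> > 0"
  obtains d where "d > 0"
    and "\<And>a b s F. \<lbrakk>a \<in> {t0..T}; b \<in> {t0..T}; \<bar>b - a\<bar> < d; a \<le> s; b \<le> s\<rbrakk> \<Longrightarrow>
      norm1 F (heat \<nu> (s - b) (y b) - heat \<nu> (s - a) (y a)) \<le> \<omega>"
proof -
  \<comment> \<open>A majorant of the norm to be estimated, continuous on a compact square and zero
    on the diagonal; comparing (a, b) with (a, a) bounds it.\<close>
  define g where "g z = (\<Sum>k\<in>K. norm k * (norm (y (snd z) k - y (fst z) k)
    + \<nu> * (norm k)\<^sup>2 * \<bar>snd z - fst z\<bar> * norm (y (fst z) k)))" for z
  let ?Q = "{t0..T} \<times> {t0..T}"
  have "continuous_on ?Q (\<lambda>z. y (fst z) k)" "continuous_on ?Q (\<lambda>z. y (snd z) k)" for k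
    by (auto intro!: continuous_on_compose2[OF y_continuous] continuous_intros)
  then have "continuous_on ?Q g"
    unfolding g_def by (intro continuous_intros)
  then have "uniformly_continuous_on ?Q g"
    by (intro compact_uniformly_continuous compact_Times) auto
  then obtain d where "d > 0" and d: "\<And>z z'. z \<in> ?Q \<Longrightarrow> z' \<in> ?Q \<Longrightarrow> dist z' z < d \<Longrightarrow> dist (g z') (g z) < \<omega>"
    using assms unfolding uniformly_continuous_on_def by meson
  show thesis
  proof (rule that[OF \<open>d > 0\<close>])
    fix a b s F
    assume ab: "a \<in> {t0..T}" "b \<in> {t0..T}" "\<bar>b - a\<bar> < d" "a \<le> s" "b \<le> s"
    have "dist (a, b) (a, a) < d"
      using ab(3) by (simp add: dist_Pair_Pair dist_real_def)
    then have "dist (g (a, b)) (g (a, a)) < \<omega>"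
      using ab by (intro d) auto
    moreover have "g (a, a) = 0" by (simp add: g_def)
    ultimately have g: "g (a, b) < \<omega>" by (simp add: dist_real_def)
    let ?e = "\<lambda>t k. exp (- (\<nu> * (s - t) * (norm k)\<^sup>2))"
    have "norm1 F (heat \<nu> (s - b) (y b) - heat \<nu> (s - a) (y a))
        \<le> (\<Sum>k\<in>K. norm k * norm ((heat \<nu> (s - b) (y b) - heat \<nu> (s - a) (y a)) k))"
      by (rule norm1_le_sum[OF K]) (simp add: heat_def y_support)
    also have "\<dots> \<le> g (a, b)"
      unfolding g_def
    proof (intro sum_mono mult_left_mono)
      fix k
      have "(heat \<nu> (s - b) (y b) - heat \<nu> (s - a) (y a)) k
          = ?e b k *\<^sub>R (y b k - y a k) + (?e b k - ?e a k) *\<^sub>R y a k"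
        by (simp add: heat_def algebra_simps)
      then have "norm ((heat \<nu> (s - b) (y b) - heat \<nu> (s - a) (y a)) k)
          \<le> ?e b k * norm (y b k - y a k) + \<bar>?e b k - ?e a k\<bar> * norm (y a k)"
        using norm_triangle_ineq[of "?e b k *\<^sub>R (y b k - y a k)" "(?e b k - ?e a k) *\<^sub>R y a k"] by simp
      also have "\<dots> \<le> 1 * norm (y b k - y a k)
          + \<bar>\<nu> * (s - b) * (norm k)\<^sup>2 - \<nu> * (s - a) * (norm k)\<^sup>2\<bar> * norm (y a k)"
        using ab \<nu> by (intro add_mono mult_right_mono abs_exp_minus_diff_le) auto
      also have "\<nu> * (s - b) * (norm k)\<^sup>2 - \<nu> * (s - a) * (norm k)\<^sup>2 = \<nu> * (norm k)\<^sup>2 * (a - b)"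
        by (simp add: algebra_simps)
      finally show "norm ((heat \<nu> (s - b) (y b) - heat \<nu> (s - a) (y a)) k)
        \<le> norm (y (snd (a, b)) k - y (fst (a, b)) k)
          + \<nu> * (norm k)\<^sup>2 * \<bar>snd (a, b) - fst (a, b)\<bar> * norm (y (fst (a, b)) k)"
        using \<nu> by (simp add: abs_mult abs_minus_commute)
    qed auto
    finally show "norm1 F (heat \<nu> (s - b) (y b) - heat \<nu> (s - a) (y a)) \<le> \<omega>"
      using g by simp
  qed
qed

lemma norm1_J_le:
  assumes "u \<in> Vspace L 1"
  shows "norm1 F (J u) \<le> (\<Sum>k\<in>K. norm k) * cJ * Vnorm L 1 u"
proof -
  have "norm1 F (J u) \<le> (\<Sum>k\<in>K. norm k * norm (J u k))"
    by (rule norm1_le_sum[OF K J_support])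
  also have "\<dots> \<le> (\<Sum>k\<in>K. norm k * (cJ * Vnorm L 1 u))"
    by (intro sum_mono mult_left_mono J_bound assms) auto
  finally show ?thesis by (simp add: sum_distrib_right mult.assoc)
qed

section \<open>The weighted Gronwall argument for the insertion error\<close>

lemma Vnorm_w_continuous:
  assumes "0 \<le> \<delta>"
  shows "continuous_on {tm \<delta> n..} (\<lambda>\<tau>. Vnorm L 1 (w \<delta> n \<tau>))"
  using ns_solution_Vnorm_continuous[OF L S_solution[OF un_in[OF assms]] v, of "{tm \<delta> n..}" "- tm \<delta> n"]
    tm_ge[OF assms, of n]
  by (simp add: w_def)

text \<open>The constant \<open>c\<close> is the rate at which the force is taken out of the
  pairing. On a complete interval it is the pairing with y at the right endpoint, so that c times
  the length is what the insertion adds back; on the last, incomplete interval it is 0. The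
  differences of powers 1/8 telescope over the intervals.\<close>

lemma inner1_w_step:
  assumes C: "C \<ge> 0"
      "\<And>r F p u v. \<lbrakk>r > 0; finite F; u \<in> Vspace L 1; v \<in> Vspace L 1\<rbrakk> \<Longrightarrow>
        \<bar>inner1 F p (heat \<nu> r (B L u v))\<bar> \<le> C * r powr (-3/4) * norm1 F p * (Vnorm L 1 u * Vnorm L 1 v)"
    and M: "\<And>\<tau>. t0 \<le> \<tau> \<Longrightarrow> \<tau> \<le> T \<Longrightarrow> Vnorm L 1 (v \<tau>) \<le> M"
    and "0 \<le> \<delta>" "0 < \<beta>" "0 \<le> \<eta>" "finite F"
    and b: "tm \<delta> n \<le> b" "b \<le> s" "s \<le> T"
    and small: "\<eta> * exp (\<beta> * (s - t0)) \<le> 1"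
    and hyp: "\<And>\<tau>. tm \<delta> n < \<tau> \<Longrightarrow> \<tau> < b \<Longrightarrow> Vnorm L 1 (w \<delta> n \<tau>) \<le> \<eta> * exp (\<beta> * (\<tau> - t0))"
    and c: "\<And>\<tau>. tm \<delta> n < \<tau> \<Longrightarrow> \<tau> < b \<Longrightarrow> c - inner1 F p (heat \<nu> (s - \<tau>) (y \<tau>)) \<le> \<omega> * norm1 F p"
  shows "inner1 F p (heat \<nu> (s - b) (w \<delta> n b)) + c * (b - tm \<delta> n)
    \<le> inner1 F p (heat \<nu> (s - tm \<delta> n) (w \<delta> n (tm \<delta> n))) + norm1 F p * (\<omega> * (b - tm \<delta> n)
      + 8 * C * (1 + 2 * M) * \<beta> powr (-1/8) * (\<eta> * exp (\<beta> * (s - t0)))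
        * ((s - tm \<delta> n) powr (1/8) - (s - b) powr (1/8)))"
proof -
  let ?a = "tm \<delta> n" and ?P = "norm1 F p" and ?\<Phi> = "\<eta> * exp (\<beta> * (s - t0))"
  let ?u = "\<lambda>t. S t (un \<delta> n)"
  define K' where "K' = ?P * (C * (1 + 2 * M) * \<beta> powr (-1/8) * ?\<Phi>)"
  have a: "t0 \<le> ?a" using tm_ge assms by simp
  have M0: "0 \<le> M" using M[of s] a b Vnorm_nonneg[of L 1 "v s"] by linarith
  have sol: "ns_solution L \<nu> (\<lambda>_. f) 0 ?u" by (intro S_solution un_in assms)
  let ?\<phi> = "\<lambda>\<tau>. inner1 F p (heat \<nu> (s - \<tau>) (w \<delta> n \<tau>))"
  let ?D = "\<lambda>\<tau>. B L (?u (\<tau> - ?a)) (?u (\<tau> - ?a)) - B L (v \<tau>) (v \<tau>)"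
  let ?\<phi>' = "\<lambda>\<tau>. inner1 F p (heat \<nu> (s - \<tau>) (f - (f + y \<tau>) - ?D \<tau>))"
  have "?\<phi> b \<le> ?\<phi> ?a + (\<omega> * ?P - c) * (b - ?a) + 8 * K' * ((s - ?a) powr (1/8) - (s - b) powr (1/8))"
  proof (rule nonincreasing_from_singular_derivative[of ?a b s ?\<phi> ?\<phi>'])
    show "continuous_on {?a..b} ?\<phi>"
      using inner1_heat_difference_continuous[OF L sol v, where S = "{?a..b}" and c = "- ?a" and F = F
          and p = p and s = s] a
      by (auto simp: w_def)
    fix \<tau> assume \<tau>: "?a < \<tau>" "\<tau> < b"
    show "(?\<phi> has_real_derivative ?\<phi>' \<tau>) (at \<tau>)"
      using inner1_heat_difference_derivative[OF L sol v, where \<tau> = \<tau> and c = "- ?a" and F = F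
          and p = p and s = s] a \<tau>
      by (simp add: w_def y_def)
    have V: "w \<delta> n \<tau> \<in> Vspace L 1" "v \<tau> \<in> Vspace L 1" "?u (\<tau> - ?a) \<in> Vspace L 1"
      using \<tau> a assms by (auto intro: w_in v_in S_in un_in)
    let ?r = "s - \<tau>" and ?N = "Vnorm L 1 (w \<delta> n \<tau>)"
    have r: "?r > 0" using \<tau> b by simp
    have "?D \<tau> = B L (w \<delta> n \<tau>) (w \<delta> n \<tau>) + B L (w \<delta> n \<tau>) (v \<tau>) + B L (v \<tau>) (w \<delta> n \<tau>)"
      using B_diff[OF L V(3,2)] by (simp add: w_def fun_eq_iff)
    then have "\<bar>inner1 F p (heat \<nu> ?r (?D \<tau>))\<bar> \<le>
        \<bar>inner1 F p (heat \<nu> ?r (B L (w \<delta> n \<tau>) (w \<delta> n \<tau>)))\<bar>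
        + \<bar>inner1 F p (heat \<nu> ?r (B L (w \<delta> n \<tau>) (v \<tau>)))\<bar>
        + \<bar>inner1 F p (heat \<nu> ?r (B L (v \<tau>) (w \<delta> n \<tau>)))\<bar>"
      by (simp add: heat_add inner1_add)
    also have "\<dots> \<le> C * ?r powr (-3/4) * ?P * (?N * ?N)
        + C * ?r powr (-3/4) * ?P * (?N * Vnorm L 1 (v \<tau>))
        + C * ?r powr (-3/4) * ?P * (Vnorm L 1 (v \<tau>) * ?N)"
      by (intro add_mono C(2) r \<open>finite F\<close> V)
    also have "\<dots> = C * ?r powr (-3/4) * ?P * (?N * (?N + 2 * Vnorm L 1 (v \<tau>)))"
      by (simp add: algebra_simps)
    also have "\<dots> \<le> C * ?r powr (-3/4) * ?P * (\<eta> * exp (\<beta> * (\<tau> - t0)) * (1 + 2 * M))"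
    \<comment> \<open>In the quadratic term one factor keeps the weighted bound and the other is
      replaced by 1, which linearises the estimate.\<close>
    proof (intro mult_left_mono mult_mono add_mono)
      show "?N \<le> \<eta> * exp (\<beta> * (\<tau> - t0))" using hyp \<tau> by simp
      also have "\<dots> \<le> ?\<Phi>"
        using assms \<tau> b by (intro mult_left_mono) auto
      finally show "?N \<le> 1" using small by simp
      show "Vnorm L 1 (v \<tau>) \<le> M" using M a \<tau> b by simp
    qed (use C(1) assms M0 in \<open>auto simp: norm1_nonneg Vnorm_nonneg\<close>)
    also have "exp (\<beta> * (\<tau> - t0)) = exp (\<beta> * (s - t0)) * exp (- (\<beta> * ?r))"
      by (simp add: exp_add[symmetric] algebra_simps)
    also have "C * ?r powr (-3/4) * ?P * (\<eta> * (exp (\<beta> * (s - t0)) * exp (- (\<beta> * ?r))) * (1 + 2 * M))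
        = ?P * (C * (1 + 2 * M) * ?\<Phi>) * (?r powr (-3/4) * exp (- (\<beta> * ?r)))"
      by (simp add: mult_ac)
    also have "\<dots> \<le> ?P * (C * (1 + 2 * M) * ?\<Phi>) * (\<beta> powr (-1/8) * ?r powr (-7/8))"
      using r assms M0 C(1) norm1_nonneg by (intro mult_left_mono powr_exp_le) auto
    also have "\<dots> = K' * ?r powr (-7/8)"
      by (simp add: K'_def mult_ac)
    finally have "\<bar>inner1 F p (heat \<nu> ?r (?D \<tau>))\<bar> \<le> K' * ?r powr (-7/8)" .
    moreover have "f - (f + y \<tau>) - ?D \<tau> = (-1) \<cdot>\<^sub>S y \<tau> - ?D \<tau>"
      by (simp add: fun_eq_iff)
    then have "?\<phi>' \<tau> = - inner1 F p (heat \<nu> ?r (y \<tau>)) - inner1 F p (heat \<nu> ?r (?D \<tau>))"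
      by (simp only: heat_diff inner1_diff heat_smul inner1_smul)
    ultimately show "?\<phi>' \<tau> \<le> \<omega> * ?P - c + K' * ?r powr (-7/8)"
      using c[OF \<tau>] by linarith
  qed (use b in auto)
  then show ?thesis
    by (simp add: K'_def algebra_simps)
qed

text \<open>Three contributions remain: the quadrature error \<omega> over complete intervals, the
  uncompensated force on the last one, and a multiple of the weight that is small for large \<beta>.
  The assumption on the current interval stops strictly before s, so that s may be the first time at
  which the weighted bound fails.\<close>

lemma Vnorm_w_le:
  assumes C: "C \<ge> 0"
      "\<And>r F p u v. \<lbrakk>r > 0; finite F; u \<in> Vspace L 1; v \<in> Vspace L 1\<rbrakk> \<Longrightarrow>
        \<bar>inner1 F p (heat \<nu> r (B L u v))\<bar> \<le> C * r powr (-3/4) * norm1 F p * (Vnorm L 1 u * Vnorm L 1 v)"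
    and M: "\<And>\<tau>. t0 \<le> \<tau> \<Longrightarrow> \<tau> \<le> T \<Longrightarrow> Vnorm L 1 (v \<tau>) \<le> M"
    and Y: "\<And>\<tau> F. t0 \<le> \<tau> \<Longrightarrow> \<tau> \<le> T \<Longrightarrow> norm1 F (y \<tau>) \<le> Y"
    and \<omega>: "\<And>a b s F. \<lbrakk>a \<in> {t0..T}; b \<in> {t0..T}; \<bar>b - a\<bar> \<le> \<delta>; a \<le> s; b \<le> s\<rbrakk> \<Longrightarrow>
        norm1 F (heat \<nu> (s - b) (y b) - heat \<nu> (s - a) (y a)) \<le> \<omega>"
    and pos: "0 < \<delta>" "0 < \<beta>" "0 \<le> \<eta>" and \<delta>: "\<beta> * \<delta> \<le> 1"
    and s: "tm \<delta> n \<le> s" "s \<le> tm \<delta> n + \<delta>" "s \<le> T"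
    and small: "\<eta> * exp (\<beta> * (T - t0)) \<le> 1"
    and hyp: "\<And>j \<tau>. j < n \<Longrightarrow> tm \<delta> j \<le> \<tau> \<Longrightarrow> \<tau> \<le> tm \<delta> (Suc j) \<Longrightarrow>
        Vnorm L 1 (w \<delta> j \<tau>) \<le> \<eta> * exp (\<beta> * (\<tau> - t0))"
      "\<And>\<tau>. tm \<delta> n \<le> \<tau> \<Longrightarrow> \<tau> < s \<Longrightarrow> Vnorm L 1 (w \<delta> n \<tau>) \<le> \<eta> * exp (\<beta> * (\<tau> - t0))"
  shows "Vnorm L 1 (w \<delta> n s) \<le> L * (\<omega> * (T - t0) + Y * \<delta>
    + (8 * C * (1 + 2 * M) * (T - t0) powr (1/8) * \<beta> powr (-1/8) + \<mu> * ((\<Sum>k\<in>K. norm k) * cJ) * exp 1 / \<beta>)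
      * (\<eta> * exp (\<beta> * (s - t0))))"
proof -
  define \<Phi> where "\<Phi> = \<eta> * exp (\<beta> * (s - t0))"
  define H where "H = 8 * C * (1 + 2 * M) * \<beta> powr (-1/8) * \<Phi>"
  define G where "G = \<mu> * ((\<Sum>k\<in>K. norm k) * cJ) * exp 1 / \<beta>"
  define R where "R = \<omega> * (T - t0) + Y * \<delta> + (H * (T - t0) powr (1/8) + G * \<Phi>)"
  have t: "t0 \<le> tm \<delta> j" for j using tm_ge pos by simp
  have \<omega>0: "0 \<le> \<omega>" and Y0: "0 \<le> Y" and M0: "0 \<le> M"
    using \<omega>[of t0 t0 t0 "{}"] Y[of t0 "{}"] M[of t0] T pos Vnorm_nonneg[of L 1 "v t0"]
    by (auto simp: norm1_def)
  have \<Phi>0: "0 \<le> \<Phi>" and H0: "0 \<le> H" and G0: "0 \<le> G"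
    using pos C(1) M0 \<mu> cJ by (auto simp: \<Phi>_def H_def G_def sum_nonneg)
  have s0: "t0 \<le> s" using t[of n] s by simp
  have small': "\<eta> * exp (\<beta> * (s - t0)) \<le> 1"
  proof -
    have "\<eta> * exp (\<beta> * (s - t0)) \<le> \<eta> * exp (\<beta> * (T - t0))"
      using pos s by (intro mult_left_mono) auto
    then show ?thesis using small by simp
  qed
  have "Vnorm L 1 (w \<delta> n s) \<le> L * R"
  proof (rule Vnorm1_le[OF L])
    show "0 \<le> R"
      using \<omega>0 Y0 H0 G0 \<Phi>0 T pos unfolding R_def by (intro add_nonneg_nonneg mult_nonneg_nonneg) auto
    fix F :: "(real^2) set" assume F: "finite F"
    define p where "p = w \<delta> n s"
    define P where "P = norm1 F p"
    have P0: "0 \<le> P" by (simp add: P_def norm1_nonneg)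
    define \<phi> where "\<phi> j \<tau> = inner1 F p (heat \<nu> (s - \<tau>) (w \<delta> j \<tau>))" for j \<tau>
    \<comment> \<open>Each of the three terms is a sum of increments over the intervals, so that
      adding one interval turns \<open>Q j\<close> into \<open>Q (Suc j)\<close> exactly.\<close>
    define Q where "Q j = \<omega> * (tm \<delta> j - t0) + H * ((s - t0) powr (1/8) - (s - tm \<delta> j) powr (1/8))
      + G * \<eta> * (exp (\<beta> * (tm \<delta> j - t0)) - 1)" for j
    have "\<phi> j (tm \<delta> j) \<le> P * Q j" if "j \<le> n" for j
      using that
    proof (induction j)
      case 0
      have "inner1 F p (heat \<nu> r 0) = 0" for r
        by (simp add: inner1_def heat_def)
      then show ?case
        using w_0[of \<delta>] pos by (simp add: \<phi>_def Q_def)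
    next
      case (Suc j)
      let ?a = "tm \<delta> j" and ?b = "tm \<delta> (Suc j)"
      let ?y = "heat \<nu> (s - ?b) (y ?b)"
      have ab: "?a \<le> ?b" "?b \<le> s" "?b \<le> T" "?b - ?a = \<delta>" "t0 \<le> ?a" "t0 \<le> ?b"
        using tm_mono[of \<delta> "Suc j" n] Suc.prems pos s t t[of "Suc j"] by (auto simp: tm_Suc)
      have "\<phi> j ?b + inner1 F p ?y * (?b - ?a) \<le> \<phi> j ?a + P * (\<omega> * (?b - ?a)
          + H * ((s - ?a) powr (1/8) - (s - ?b) powr (1/8)))"
        unfolding \<phi>_def P_def H_def \<Phi>_def
      proof (rule inner1_w_step[OF C M _ pos(2,3) F ab(1,2) s(3) small'])
        show "Vnorm L 1 (w \<delta> j \<tau>) \<le> \<eta> * exp (\<beta> * (\<tau> - t0))" if "?a < \<tau>" "\<tau> < ?b" for \<tau>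
          using hyp(1)[of j \<tau>] Suc.prems that by simp
        show "inner1 F p ?y - inner1 F p (heat \<nu> (s - \<tau>) (y \<tau>)) \<le> \<omega> * norm1 F p"
          if \<tau>: "?a < \<tau>" "\<tau> < ?b" for \<tau>
        proof -
          have "inner1 F p ?y - inner1 F p (heat \<nu> (s - \<tau>) (y \<tau>))
              \<le> norm1 F p * norm1 F (?y - heat \<nu> (s - \<tau>) (y \<tau>))"
            using abs_inner1_le[of F p "?y - heat \<nu> (s - \<tau>) (y \<tau>)"] by (simp add: inner1_diff)
          also have "\<dots> \<le> norm1 F p * \<omega>"
            using ab \<tau> by (intro mult_left_mono \<omega> norm1_nonneg) auto
          finally show ?thesis by (simp add: mult.commute)
        qed
      qed (use pos in auto)
      \<comment> \<open>The gain \<delta> times the pairing with \<open>?y\<close> cancels the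
        extracted term exactly, as ?b - ?a = \<delta>; only the feedback of \<open>J\<close> is
        left.\<close>
      moreover have "\<phi> (Suc j) ?b = \<phi> j ?b + \<delta> * inner1 F p ?y
          - \<mu> * \<delta> * inner1 F p (heat \<nu> (s - ?b) (J (w \<delta> j ?b)))"
        unfolding \<phi>_def using pos
        by (simp only: w_Suc less_imp_le heat_add heat_diff heat_smul inner1_add inner1_diff inner1_smul)
      moreover have "- (\<mu> * \<delta> * inner1 F p (heat \<nu> (s - ?b) (J (w \<delta> j ?b))))
          \<le> P * (G * \<eta> * (exp (\<beta> * (?b - t0)) - exp (\<beta> * (?a - t0))))"
      proof -
        have w: "w \<delta> j ?b \<in> Vspace L 1" using ab pos by (intro w_in) auto
        have "- inner1 F p (heat \<nu> (s - ?b) (J (w \<delta> j ?b))) \<le> P * norm1 F (heat \<nu> (s - ?b) (J (w \<delta> j ?b)))"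
          unfolding P_def using abs_inner1_le[of F p "heat \<nu> (s - ?b) (J (w \<delta> j ?b))"] by linarith
        also have "\<dots> \<le> P * norm1 F (J (w \<delta> j ?b))"
          using \<nu> ab by (intro mult_left_mono norm1_heat_le P0) auto
        also have "\<dots> \<le> P * ((\<Sum>k\<in>K. norm k) * cJ * Vnorm L 1 (w \<delta> j ?b))"
          by (intro mult_left_mono norm1_J_le w P0)
        also have "\<dots> \<le> P * ((\<Sum>k\<in>K. norm k) * cJ * (\<eta> * exp (\<beta> * (?b - t0))))"
          using hyp(1)[of j ?b] Suc.prems ab cJ P0 by (intro mult_left_mono) (auto simp: sum_nonneg)
        finally have "\<mu> * \<delta> * - inner1 F p (heat \<nu> (s - ?b) (J (w \<delta> j ?b)))
            \<le> \<mu> * \<delta> * (P * ((\<Sum>k\<in>K. norm k) * cJ * (\<eta> * exp (\<beta> * (?b - t0)))))"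
          using \<mu> pos by (intro mult_left_mono) auto
        also have "\<dots> = P * (\<mu> * ((\<Sum>k\<in>K. norm k) * cJ) * \<eta>) * (\<delta> * exp (\<beta> * (?b - t0)))"
          by (simp add: mult_ac)
        also have "\<beta> * (?b - t0) = \<beta> * (?a - t0) + \<beta> * \<delta>"
          by (simp add: tm_Suc algebra_simps)
        also have "P * (\<mu> * ((\<Sum>k\<in>K. norm k) * cJ) * \<eta>) * (\<delta> * exp (\<beta> * (?a - t0) + \<beta> * \<delta>))
            \<le> P * (\<mu> * ((\<Sum>k\<in>K. norm k) * cJ) * \<eta>)
              * (exp 1 / \<beta> * (exp (\<beta> * (?a - t0) + \<beta> * \<delta>) - exp (\<beta> * (?a - t0))))"
          using pos \<delta> P0 \<mu> cJ
          by (intro mult_left_mono mult_le_exp_diff) (auto intro!: mult_nonneg_nonneg sum_nonneg)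
        finally show ?thesis
          by (simp add: G_def tm_Suc algebra_simps)
      qed
      moreover have "\<phi> j ?a \<le> P * Q j" using Suc by simp
      ultimately have "\<phi> (Suc j) ?b \<le> P * Q j + P * (\<omega> * (?b - ?a)
          + H * ((s - ?a) powr (1/8) - (s - ?b) powr (1/8)))
          + P * (G * \<eta> * (exp (\<beta> * (?b - t0)) - exp (\<beta> * (?a - t0))))"
        unfolding ab(4) by (simp add: mult.commute)
      also have "\<dots> = P * Q (Suc j)"
        by (simp add: Q_def algebra_simps)
      finally show ?case .
    qed
    from this[of n] have 1: "\<phi> n (tm \<delta> n) \<le> P * Q n" by simp
    \<comment> \<open>No insertion has yet compensated the force since the last observation time, so
      c = 0 and the force is bounded outright.\<close>
    have "\<phi> n s + 0 * (s - tm \<delta> n) \<le> \<phi> n (tm \<delta> n) + P * (Y * (s - tm \<delta> n)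
        + H * ((s - tm \<delta> n) powr (1/8) - (s - s) powr (1/8)))"
      unfolding \<phi>_def P_def H_def \<Phi>_def
    proof (rule inner1_w_step[OF C M _ pos(2,3) F s(1) order_refl s(3) small'])
      show "Vnorm L 1 (w \<delta> n \<tau>) \<le> \<eta> * exp (\<beta> * (\<tau> - t0))" if "tm \<delta> n < \<tau>" "\<tau> < s" for \<tau>
        using hyp(2)[of \<tau>] that by simp
      show "0 - inner1 F p (heat \<nu> (s - \<tau>) (y \<tau>)) \<le> Y * norm1 F p"
        if \<tau>: "tm \<delta> n < \<tau>" "\<tau> < s" for \<tau>
      proof -
        have "0 - inner1 F p (heat \<nu> (s - \<tau>) (y \<tau>)) \<le> norm1 F p * norm1 F (heat \<nu> (s - \<tau>) (y \<tau>))"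
          using abs_inner1_le[of F p "heat \<nu> (s - \<tau>) (y \<tau>)"] by linarith
        also have "\<dots> \<le> norm1 F p * norm1 F (y \<tau>)"
          using \<tau> \<nu> by (intro mult_left_mono norm1_heat_le norm1_nonneg) auto
        also have "\<dots> \<le> norm1 F p * Y"
          using \<tau> t[of n] s by (intro mult_left_mono Y norm1_nonneg) auto
        finally show ?thesis by (simp add: mult.commute)
      qed
    qed (use pos in auto)
    \<comment> \<open>At \<tau> = s the heat factor is the identity and p is paired with itself;
      cancelling one factor P gives the norm.\<close>
    moreover have "\<phi> n s = P\<^sup>2"
      by (simp add: \<phi>_def P_def p_def inner1_self)
    ultimately have "P\<^sup>2 \<le> P * (Q n + (Y * (s - tm \<delta> n) + H * (s - tm \<delta> n) powr (1/8)))"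
      using 1 by (simp add: distrib_left)
    also have "\<dots> \<le> P * R"
    proof (intro mult_left_mono P0)
      have "\<omega> * (tm \<delta> n - t0) \<le> \<omega> * (T - t0)"
        using s \<omega>0 by (intro mult_left_mono) auto
      moreover have "Y * (s - tm \<delta> n) \<le> Y * \<delta>"
        using s Y0 by (intro mult_left_mono) auto
      moreover have "H * (s - t0) powr (1/8) \<le> H * (T - t0) powr (1/8)"
        using s s0 H0 by (intro mult_left_mono powr_mono2) auto
      moreover have "G * \<eta> * (exp (\<beta> * (tm \<delta> n - t0)) - 1) \<le> G * \<eta> * exp (\<beta> * (s - t0))"
      proof (intro mult_left_mono)
        have "exp (\<beta> * (tm \<delta> n - t0)) \<le> exp (\<beta> * (s - t0))"
          using s pos by simp
        then show "exp (\<beta> * (tm \<delta> n - t0)) - 1 \<le> exp (\<beta> * (s - t0))" by linarith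
      qed (use G0 pos in auto)
      ultimately show "Q n + (Y * (s - tm \<delta> n) + H * (s - tm \<delta> n) powr (1/8)) \<le> R"
        by (simp add: Q_def R_def \<Phi>_def algebra_simps)
    qed
    finally have "P * P \<le> P * R" by (simp add: power2_eq_square)
    then have "P \<le> R"
      using \<open>0 \<le> R\<close> P0 by (cases "P = 0") auto
    then show "L2_set (\<lambda>k. norm k * norm (w \<delta> n s k)) F \<le> R"
      by (simp add: P_def p_def norm1_def)
  qed
  then show ?thesis
    by (simp add: R_def H_def G_def \<Phi>_def algebra_simps)
qed

text \<open>The order of choice \<beta>, \<eta>, \<omega>, d avoids circularity: \<beta> depends on
  the problem data and the bound for v, but neither on the accuracy nor on the time step.\<close>

lemma eventually_Vnorm_w_le:
  assumes "\<epsilon> > 0"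
  obtains d where "d > 0"
    and "\<And>\<delta> n \<tau>. \<lbrakk>0 < \<delta>; \<delta> < d; tm \<delta> n \<le> \<tau>; \<tau> \<le> tm \<delta> (Suc n); \<tau> \<le> T\<rbrakk> \<Longrightarrow> Vnorm L 1 (w \<delta> n \<tau>) \<le> \<epsilon>"
proof -
  obtain C where C: "C \<ge> 0"
      "\<And>r F p u v. \<lbrakk>r > 0; finite F; u \<in> Vspace L 1; v \<in> Vspace L 1\<rbrakk> \<Longrightarrow>
        \<bar>inner1 F p (heat \<nu> r (B L u v))\<bar> \<le> C * r powr (-3/4) * norm1 F p * (Vnorm L 1 u * Vnorm L 1 v)"
    using B_pairing[OF L \<nu>] by metis
  obtain M where M: "\<And>\<tau>. t0 \<le> \<tau> \<Longrightarrow> \<tau> \<le> T \<Longrightarrow> Vnorm L 1 (v \<tau>) \<le> M"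
    using v_bounded by metis
  obtain Y where Y0: "Y \<ge> 0" and Y: "\<And>\<tau> F. t0 \<le> \<tau> \<Longrightarrow> \<tau> \<le> T \<Longrightarrow> norm1 F (y \<tau>) \<le> Y"
    using y_bounded by metis
  define A where "A = 8 * C * (1 + 2 * M) * (T - t0) powr (1/8)"
  define G where "G = \<mu> * ((\<Sum>k\<in>K. norm k) * cJ) * exp 1"
  \<comment> \<open>Both gains from the weight improve without limit as \<beta> grows; the value 1/4
    leaves room for the two source terms.\<close>
  have "((\<lambda>\<beta>::real. L * (A * \<beta> powr (-1/8) + G / \<beta>)) \<longlongrightarrow> L * (A * 0 + 0)) at_top"
    by (intro tendsto_intros tendsto_neg_powr filterlim_ident tendsto_divide_0[OF tendsto_const]
        filterlim_at_top_imp_at_infinity) auto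
  then have "\<forall>\<^sub>F \<beta> in at_top. L * (A * \<beta> powr (-1/8) + G / \<beta>) < 1/4"
    by (rule order_tendstoD(2)) simp
  then have "\<forall>\<^sub>F \<beta>::real in at_top. \<beta> > 0 \<and> L * (A * \<beta> powr (-1/8) + G / \<beta>) < 1/4"
    using eventually_gt_at_top[of 0] by eventually_elim simp
  then obtain \<beta> where \<beta>: "\<beta> > 0" "L * (A * \<beta> powr (-1/8) + G / \<beta>) < 1/4"
    using eventually_happens'[OF trivial_limit_at_top_linorder] by blast
  \<comment> \<open>The weight reaches min \<epsilon> 1 at time T: the 1 linearises the quadratic
    term, \<epsilon> is the accuracy wanted.\<close>
  define \<eta> where "\<eta> = min \<epsilon> 1 / exp (\<beta> * (T - t0))"
  have \<eta>: "\<eta> > 0" "\<eta> * exp (\<beta> * (T - t0)) = min \<epsilon> 1"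
    using assms by (auto simp: \<eta>_def)
  define \<omega> where "\<omega> = \<eta> / (8 * L * (T - t0))"
  have \<omega>: "\<omega> > 0" "L * (\<omega> * (T - t0)) = \<eta> / 8"
    using \<eta>(1) L T by (auto simp: \<omega>_def)
  obtain d1 where "d1 > 0"
    and d1: "\<And>a b s F. \<lbrakk>a \<in> {t0..T}; b \<in> {t0..T}; \<bar>b - a\<bar> < d1; a \<le> s; b \<le> s\<rbrakk> \<Longrightarrow>
      norm1 F (heat \<nu> (s - b) (y b) - heat \<nu> (s - a) (y a)) \<le> \<omega>"
    using heat_y_modulus[OF \<omega>(1)] by metis
  \<comment> \<open>The three bounds give the modulus \<omega> of the force, \<beta> \<delta> <= 1,
    and L Y \<delta> <= \<eta>/8; Y + 1 guards against Y = 0.\<close>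
  define d where "d = min d1 (min (1 / \<beta>) (\<eta> / (8 * L * (Y + 1))))"
  show thesis
  proof (rule that[of d])
    show "d > 0" using \<open>d1 > 0\<close> \<beta>(1) \<eta>(1) L Y0 by (simp add: d_def)
    fix \<delta> n \<tau>
    assume \<delta>: "0 < \<delta>" "\<delta> < d" and \<tau>: "tm \<delta> n \<le> \<tau>" "\<tau> \<le> tm \<delta> (Suc n)" "\<tau> \<le> T"
    have \<delta>': "\<delta> < d1" "\<beta> * \<delta> \<le> 1" "L * (Y * \<delta>) \<le> \<eta> / 8"
    proof -
      show "\<delta> < d1" using \<delta> by (simp add: d_def)
      have "\<delta> \<le> 1 / \<beta>" using \<delta> by (simp add: d_def)
      then show "\<beta> * \<delta> \<le> 1" using \<beta>(1) by (simp add: field_simps)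
      have "\<delta> \<le> \<eta> / (8 * L * (Y + 1))" using \<delta> by (simp add: d_def)
      then have "\<delta> * (8 * L * (Y + 1)) \<le> \<eta>"
        using L Y0 by (simp add: pos_le_divide_eq)
      moreover have "\<delta> * (8 * L * Y) \<le> \<delta> * (8 * L * (Y + 1))"
        using L \<delta> by (intro mult_left_mono) auto
      ultimately show "L * (Y * \<delta>) \<le> \<eta> / 8" by (simp add: mult_ac)
    qed
    let ?\<Phi> = "\<lambda>\<tau>. \<eta> * exp (\<beta> * (\<tau> - t0))"
    have good: "Vnorm L 1 (w \<delta> n \<tau>) < ?\<Phi> \<tau>" if "tm \<delta> n \<le> \<tau>" "\<tau> \<le> tm \<delta> (Suc n)" "\<tau> \<le> T" for n \<tau>
      using that
    proof (induction n arbitrary: \<tau> rule: less_induct)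
      case (less n)
      show ?case
      proof (rule ccontr)
        assume bad: "\<not> Vnorm L 1 (w \<delta> n \<tau>) < ?\<Phi> \<tau>"
        \<comment> \<open>The failure times on the current interval form a compact set, whose least
          element is the first failure. A failure at the observation time itself, just after a jump,
          needs no separate treatment, since the estimate holds at s = \<open>tm \<delta> n\<close>
          too.\<close>
        define X where "X = {s \<in> {tm \<delta> n..\<tau>}. ?\<Phi> s \<le> Vnorm L 1 (w \<delta> n s)}"
        have "continuous_on {tm \<delta> n..\<tau>} (\<lambda>s. Vnorm L 1 (w \<delta> n s))"
          by (rule continuous_on_subset[OF Vnorm_w_continuous]) (use \<delta> in auto)
        then have "closed X"
          unfolding X_def by (intro continuous_on_closed_Collect_le continuous_intros) auto
        moreover have "bounded X"
          by (rule bounded_subset[of "{tm \<delta> n..\<tau>}"]) (auto simp: X_def)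
        moreover have "\<tau> \<in> X" using bad less.prems by (auto simp: X_def)
        ultimately obtain s where s: "s \<in> X" "\<And>s'. s' \<in> X \<Longrightarrow> s \<le> s'"
          using compact_attains_inf[of X] by (auto simp: compact_eq_bounded_closed)
        have s': "tm \<delta> n \<le> s" "s \<le> \<tau>" "?\<Phi> s \<le> Vnorm L 1 (w \<delta> n s)"
          using s(1) by (auto simp: X_def)
        have "Vnorm L 1 (w \<delta> n s) \<le> L * (\<omega> * (T - t0) + Y * \<delta>
          + (8 * C * (1 + 2 * M) * (T - t0) powr (1/8) * \<beta> powr (-1/8)
            + \<mu> * ((\<Sum>k\<in>K. norm k) * cJ) * exp 1 / \<beta>) * ?\<Phi> s)"
        proof (rule Vnorm_w_le[OF C M Y])
          show "norm1 F (heat \<nu> (s - b) (y b) - heat \<nu> (s - a) (y a)) \<le> \<omega>"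
            if "a \<in> {t0..T}" "b \<in> {t0..T}" "\<bar>b - a\<bar> \<le> \<delta>" "a \<le> s" "b \<le> s" for a b s F
            using that \<delta>' by (intro d1) auto
          show "Vnorm L 1 (w \<delta> j \<tau>') \<le> ?\<Phi> \<tau>'"
            if "j < n" "tm \<delta> j \<le> \<tau>'" "\<tau>' \<le> tm \<delta> (Suc j)" for j \<tau>'
            using less.IH[OF that] tm_mono[of \<delta> "Suc j" n] that less.prems \<delta> by fastforce
          show "Vnorm L 1 (w \<delta> n \<tau>') \<le> ?\<Phi> \<tau>'" if "tm \<delta> n \<le> \<tau>'" "\<tau>' < s" for \<tau>'
            using s(2)[of \<tau>'] that s' by (fastforce simp: X_def)
        qed (use \<delta> \<delta>' \<beta> \<eta> s' less.prems in \<open>auto simp: tm_Suc\<close>)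
        also have "\<dots> = \<eta> / 8 + L * (Y * \<delta>) + L * (A * \<beta> powr (-1/8) + G / \<beta>) * ?\<Phi> s"
          unfolding \<omega>(2)[symmetric] A_def[symmetric] G_def[symmetric] by (simp only: ring_distribs mult_ac)
        also have "\<dots> \<le> \<eta> / 8 + \<eta> / 8 + 1/4 * ?\<Phi> s"
          using \<delta>' \<beta> \<eta> by (intro add_mono mult_right_mono) auto
        \<comment> \<open>The weight at s is at least \<eta>, so the total is at most 1/8 + 1/8 +
          1/4 of it.\<close>
        also have "\<dots> < ?\<Phi> s"
        proof -
          have "t0 \<le> s" using tm_ge[of \<delta> n] \<delta> s' by simp
          then have "\<eta> * 1 \<le> ?\<Phi> s"
            using \<beta>(1) \<eta>(1) by (intro mult_left_mono) auto
          then show ?thesis using \<eta>(1) by linarith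
        qed
        finally show False using s'(3) by simp
      qed
    qed
    have "?\<Phi> \<tau> \<le> ?\<Phi> T"
      using \<tau> \<beta>(1) \<eta>(1) by (intro mult_left_mono) auto
    then show "Vnorm L 1 (w \<delta> n \<tau>) \<le> \<epsilon>"
      using good[OF \<tau>] \<eta>(2) by simp
  qed
qed

section \<open>Passage to the supremum over the time interval\<close>

lemma relaxed_insertion_eq_w:
  assumes "\<delta> > 0" "t0 \<le> t"
  obtains n where "tm \<delta> n \<le> t" "t \<le> tm \<delta> (Suc n)"
    and "relaxed_insertion S J U t0 \<delta> (\<mu> * \<delta>) t - v t = w \<delta> n t"
proof
  define n where "n = nat \<lfloor>(t - t0) / \<delta>\<rfloor>"
  have "real n = of_int \<lfloor>(t - t0) / \<delta>\<rfloor>"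
    using assms by (simp add: n_def)
  then have "real n \<le> (t - t0) / \<delta>" "(t - t0) / \<delta> < real n + 1"
    by linarith+
  then show "tm \<delta> n \<le> t" "t \<le> tm \<delta> (Suc n)"
    using assms(1) by (auto simp: tm_def field_simps)
  show "relaxed_insertion S J U t0 \<delta> (\<mu> * \<delta>) t - v t = w \<delta> n t"
    by (simp add: relaxed_insertion_def Let_def w_def un_def tm_def n_def)
qed

text \<open>In the extended reals the supremum need not be known to be finite beforehand. The lower
  estimate uses only the nonnegative value at t0; the upper one is uniform over the observation
  intervals, hence over t.\<close>

lemma relaxed_insertion_converges:
  "((\<lambda>\<delta>. SUP t\<in>{t0..T}. ereal (Vnorm L 1 (relaxed_insertion S J U t0 \<delta> (\<mu> * \<delta>) t - v t))) \<longlongrightarrow> 0)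
    (at_right 0)"
proof (rule order_tendstoI)
  let ?E = "\<lambda>\<delta> t. ereal (Vnorm L 1 (relaxed_insertion S J U t0 \<delta> (\<mu> * \<delta>) t - v t))"
  fix a :: ereal
  have "a < (SUP t\<in>{t0..T}. ?E \<delta> t)" if "a < 0" for \<delta>
    using that T by (intro less_SUP_iff[THEN iffD2] bexI[of _ t0])
      (auto intro: less_le_trans simp: Vnorm_nonneg)
  then show "\<forall>\<^sub>F \<delta> in at_right 0. a < (SUP t\<in>{t0..T}. ?E \<delta> t)" if "a < 0"
    using that by simp
  show "\<forall>\<^sub>F \<delta> in at_right 0. (SUP t\<in>{t0..T}. ?E \<delta> t) < a" if "0 < a"
  proof -
    obtain \<epsilon> where \<epsilon>: "0 < \<epsilon>" "ereal \<epsilon> < a"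
      using ereal_dense2[OF \<open>0 < a\<close>] by (auto simp: zero_ereal_def)
    obtain d where "d > 0" and d: "\<And>\<delta> n \<tau>. \<lbrakk>0 < \<delta>; \<delta> < d; tm \<delta> n \<le> \<tau>; \<tau> \<le> tm \<delta> (Suc n); \<tau> \<le> T\<rbrakk>
        \<Longrightarrow> Vnorm L 1 (w \<delta> n \<tau>) \<le> \<epsilon>"
      using eventually_Vnorm_w_le[OF \<epsilon>(1)] by metis
    have "(SUP t\<in>{t0..T}. ?E \<delta> t) \<le> ereal \<epsilon>" if \<delta>: "0 < \<delta>" "\<delta> < d" for \<delta>
    proof (rule SUP_least)
      fix t assume t: "t \<in> {t0..T}"
      then obtain n where "tm \<delta> n \<le> t" "t \<le> tm \<delta> (Suc n)"
          "relaxed_insertion S J U t0 \<delta> (\<mu> * \<delta>) t - v t = w \<delta> n t"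
        using relaxed_insertion_eq_w[OF \<delta>(1), of t] by auto
      then show "?E \<delta> t \<le> ereal \<epsilon>"
        using d[OF \<delta>, of n t] t by simp
    qed
    then have "\<forall>\<^sub>F \<delta> in at_right 0. (SUP t\<in>{t0..T}. ?E \<delta> t) \<le> ereal \<epsilon>"
      using \<open>d > 0\<close> by (auto simp: eventually_at_right_field)
    then show ?thesis
      using \<epsilon>(2) by (auto elim!: eventually_mono intro: le_less_trans)
  qed
qed

end

theorem theorem1p4:
  fixes L \<nu> c1 h lam \<mu> t0 :: real
    and f :: series
    and S :: "real \<Rightarrow> series \<Rightarrow> series"
    and Att :: "series set"
    and I :: "real \<Rightarrow> series \<Rightarrow> real^2 \<Rightarrow> real^2"
    and J :: "series \<Rightarrow> series"
    and U v :: "real \<Rightarrow> series"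
  assumes "L > 0" and "\<nu> > 0"
    and "f \<in> Vspace L 1"
    and "solution_semigroup L \<nu> f S"
    and "global_attractor L S Att"
    and "c1 > 0" and "\<forall>h'>0. interpolant L c1 h' (I h')"
    and "h > 0" and "lam > 0" and "\<mu> > 0"
    and "J = obs L lam (I h)"
    and "ns_solution L \<nu> (\<lambda>_. f) t0 U" and "\<forall>t\<ge>t0. U t \<in> Att"
    and "ns_solution L \<nu> (\<lambda>t. f + \<mu> \<cdot>\<^sub>S J (U t - v t)) t0 v" and "v t0 = J (U t0)"
  shows "\<forall>T>t0.
    ((\<lambda>\<delta>. SUP t\<in>{t0..T}.
        ereal (Vnorm L 1 (relaxed_insertion S J U t0 \<delta> (\<mu> * \<delta>) t - v t))) \<longlongrightarrow> 0) (at_right 0)"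
proof (intro allI impI)
  fix T assume "t0 < T"
  have I: "interpolant L c1 h (I h)" using assms(7,8) by blast
  obtain C where C: "C \<ge> 0" "\<And>u k. u \<in> Vspace L 1 \<Longrightarrow> norm (J u k) \<le> C * Vnorm L 1 u"
    using obs_bound[OF assms(1) I, of lam] unfolding assms(11) by metis
  \<comment> \<open>The spectral cutoff confines \<open>J\<close> to finitely many wave vectors,
    which is what makes the nudging force continuous into a finite-dimensional space.\<close>
  interpret nudging L \<nu> \<mu> t0 T C f S J U v "{k \<in> wavevectors L. (norm k)\<^sup>2 \<le> lam}"
  proof
    show "J u \<in> Vspace L 1" for u
      unfolding assms(11) by (rule obs_in_Vspace[OF assms(1)])
    show "J (u - u') = J u - J u'" if "u \<in> Vspace L 1" "u' \<in> Vspace L 1" for u u'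
    proof -
      have "a - b = 1 \<cdot>\<^sub>S a + (-1) \<cdot>\<^sub>S b" for a b :: series by (simp add: fun_eq_iff)
      then show ?thesis
        using obs_lincomb[OF I that, of lam 1 "-1"] unfolding assms(11) by metis
    qed
    show "J u k = 0" if "k \<notin> {k \<in> wavevectors L. (norm k)\<^sup>2 \<le> lam}" for u k
      by (rule obs_support[OF assms(11) that])
  qed (use assms \<open>t0 < T\<close> C finite_wavevectors_le in auto)
  show "((\<lambda>\<delta>. SUP t\<in>{t0..T}.
        ereal (Vnorm L 1 (relaxed_insertion S J U t0 \<delta> (\<mu> * \<delta>) t - v t))) \<longlongrightarrow> 0) (at_right 0)"
    by (rule relaxed_insertion_converges)
qed

end
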